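(* Let $T>0$, let $\{X_t\}_{t\in[0,T]}$ be a Responsive Fractional Brownian Motion with Lipschitz-Hölder response function $H$, and let $\rho(t,s;X)$ be its attention weights. For any $t\in(0,T]$ there exists a $\mathbb{P}$-null set $N\subset\Omega$ such that for all $\omega\notin N$ (all quantities evaluated at $\omega$): 1. (Positivity) $\rho(t,s;X)>0$ for all $s\in[0,t)$, and the limit $\lim_{s\to t^-}\rho(t,s;X)$ exists in $[0,+\infty]$. 2. (Normalization) $\int_0^t\rho(t,s;X)\,ds=1$. 3. (Regularity) The function $s\mapsto\rho(t,s;X)$ is continuous on $[0,t)$, and at $s=t$: - if $H(t,X_t)>1/2$, then $\lim_{s\to t^-}\rho(t,s;X)=0$, and with the convention $\rho(t,t;X)=0$ one has $\rho(t,\cdot;X)\in C[0,t]$; - if $H(t,X_t)=1/2$, then $\lim_{s\to t^-}\rho(t,s;X)=\sqrt{2H(t,X_t)}/D(t,X)\in(0,\infty)$, and $\rho(t,\cdot;X)\in C[0,t]$ (with $\rho(t,t;X)$ defined as this limit); - if $H(t,X_t)<1/2$, then $\lim_{s\to t^-}\rho(t,s;X)=+\infty$, and $\rho(t,\cdot;X)\in L^1[0,t]\setminus L^\infty[0,t]$.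
   Context: Lipschitz-Hölder response function: $H:[0,T]\times\mathbb{R}\to(0,1)$ such that there are constants $L_H>0$, $C_H>0$, $\gamma\in(0,1]$, $0<h_{\min}\le h_{\max}<1$ with, for all $t,s\in[0,T]$, $x,y\in\mathbb{R}$: (i) $|H(t,x)-H(t,y)|\le L_H|x-y|$; (ii) $|H(t,x)-H(s,x)|\le C_H|t-s|^\gamma$; (iii) $h_{\min}\le H(t,x)\le h_{\max}$. Responsive Fractional Brownian Motion (RfBm): on a filtered probability space $(\Omega,\mathcal{F},(\mathcal{F}_t)_{t\in[0,T]},\mathbb{P})$ satisfying the usual conditions with a standard $(\mathcal{F}_t)$-Brownian motion $B$, an $(\mathcal{F}_t)$-adapted process $\{X_t\}_{t\in[0,T]}$ with almost surely continuous paths such that for each $t\in[0,T]$ the Itô integral $\int_0^tK(t,s;X_s)\,dB(s)$ is well-defined and $X_t=\int_0^tK(t,s;X_s)\,dB(s)$ $\mathbb{P}$-almost surely, where $$K(t,s;X_s)=\sqrt{2H(s,X_s)}\,(t-s)^{H(s,X_s)-1/2},\qquad0\le s<t.$$ Attention weights: pathwise, for $t\in(0,T]$ and $0\le s<t$, $$\rho(t,s;X):=\frac{K(t,s;X_s)}{D(t,X)},\qquad D(t,X):=\int_0^tK(t,u;X_u)\,du.$$ *)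

theory Defs
  imports "HOL-Probability.Probability"
begin

section \<open>Filtered probability spaces and Brownian motion on $[0,T]$\<close>

text \<open>Processes and filtrations are indexed by \<open>real\<close>; only indices in \<open>{0..T}\<close> are constrained.\<close>

locale usual_filtered_prob_space = prob_space M + complete_measure M
  for M :: "'a measure" +
  fixes F :: "real \<Rightarrow> 'a measure" and T :: real
  assumes subalgebra_F: "\<And>t. t \<in> {0..T} \<Longrightarrow> subalgebra M (F t)"
    and F_mono: "\<And>s t. 0 \<le> s \<Longrightarrow> s \<le> t \<Longrightarrow> t \<le> T \<Longrightarrow> sets (F s) \<subseteq> sets (F t)"
    and null_sets_F0: "null_sets M \<subseteq> sets (F 0)"
    and F_right_continuous: "\<And>t. t \<in> {0..<T} \<Longrightarrow> sets (F t) = (\<Inter>s\<in>{t<..T}. sets (F s))"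

definition adapted_process :: "(real \<Rightarrow> 'a measure) \<Rightarrow> real \<Rightarrow> (real \<Rightarrow> 'a \<Rightarrow> real) \<Rightarrow> bool" where
  "adapted_process F T X \<longleftrightarrow> (\<forall>t\<in>{0..T}. X t \<in> borel_measurable (F t))"

definition brownian_motion ::
  "'a measure \<Rightarrow> (real \<Rightarrow> 'a measure) \<Rightarrow> real \<Rightarrow> (real \<Rightarrow> 'a \<Rightarrow> real) \<Rightarrow> bool" where
  "brownian_motion M F T B \<longleftrightarrow>
     adapted_process F T B \<and>
     (AE \<omega> in M. B 0 \<omega> = 0) \<and>
     (AE \<omega> in M. continuous_on {0..T} (\<lambda>t. B t \<omega>)) \<and>
     (\<forall>s t. 0 \<le> s \<and> s < t \<and> t \<le> T \<longrightarrow>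
        distributed M lborel (\<lambda>\<omega>. B t \<omega> - B s \<omega>) (normal_density 0 (sqrt (t - s))) \<and>
        prob_space.indep_set M (sets (F s))
          (sets (vimage_algebra (space M) (\<lambda>\<omega>. B t \<omega> - B s \<omega>) borel)))"

section \<open>The Ito integral\<close>

definition progressive ::
  "(real \<Rightarrow> 'a measure) \<Rightarrow> real \<Rightarrow> (real \<Rightarrow> 'a \<Rightarrow> real) \<Rightarrow> bool" where
  "progressive F t \<phi> \<longleftrightarrow>
     (\<forall>s\<in>{0..t}. (\<lambda>(u, \<omega>). \<phi> u \<omega>) \<in> borel_measurable (restrict_space borel {0..s} \<Otimes>\<^sub>M F s))"

text \<open>
  Square integrability is only required almost surely. The integrand is taken up to
  indistinguishability: a process with merely almost surely continuous paths need not itself be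
  jointly measurable.
\<close>

definition ito_integrand_version ::
  "'a measure \<Rightarrow> (real \<Rightarrow> 'a measure) \<Rightarrow> real \<Rightarrow> (real \<Rightarrow> 'a \<Rightarrow> real) \<Rightarrow> (real \<Rightarrow> 'a \<Rightarrow> real) \<Rightarrow> bool" where
  "ito_integrand_version M F t \<phi> \<psi> \<longleftrightarrow>
     progressive F t \<psi> \<and>
     (AE \<omega> in M. \<forall>s\<in>{0..t}. \<phi> s \<omega> = \<psi> s \<omega>) \<and>
     (AE \<omega> in M. (\<integral>\<^sup>+s\<in>{0..t}. ennreal ((\<psi> s \<omega>)\<^sup>2) \<partial>lborel) < \<infinity>)"

definition simple_process_data ::
  "'a measure \<Rightarrow> (real \<Rightarrow> 'a measure) \<Rightarrow> real \<Rightarrow> nat \<Rightarrow> (nat \<Rightarrow> real) \<Rightarrow> (nat \<Rightarrow> 'a \<Rightarrow> real) \<Rightarrow> bool" where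
  "simple_process_data M F t k \<tau> \<xi> \<longleftrightarrow>
     (\<forall>i<k. 0 \<le> \<tau> i \<and> \<tau> i \<le> \<tau> (Suc i) \<and> \<tau> (Suc i) \<le> t \<and>
        \<xi> i \<in> borel_measurable (F (\<tau> i)) \<and> (\<exists>C. \<forall>\<omega>\<in>space M. \<bar>\<xi> i \<omega>\<bar> \<le> C))"

definition simple_process ::
  "nat \<Rightarrow> (nat \<Rightarrow> real) \<Rightarrow> (nat \<Rightarrow> 'a \<Rightarrow> real) \<Rightarrow> real \<Rightarrow> 'a \<Rightarrow> real" where
  "simple_process k \<tau> \<xi> s \<omega> = (\<Sum>i<k. \<xi> i \<omega> * indicator {\<tau> i<..\<tau> (Suc i)} s)"

definition simple_integral ::
  "(real \<Rightarrow> 'a \<Rightarrow> real) \<Rightarrow> nat \<Rightarrow> (nat \<Rightarrow> real) \<Rightarrow> (nat \<Rightarrow> 'a \<Rightarrow> real) \<Rightarrow> 'a \<Rightarrow> real" where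
  "simple_integral B k \<tau> \<xi> \<omega> = (\<Sum>i<k. \<xi> i \<omega> * (B (\<tau> (Suc i)) \<omega> - B (\<tau> i) \<omega>))"

definition null_in_prob :: "'a measure \<Rightarrow> (nat \<Rightarrow> 'a \<Rightarrow> ennreal) \<Rightarrow> bool" where
  "null_in_prob M d \<longleftrightarrow>
     (\<forall>\<epsilon>>0. (\<lambda>n. measure M {\<omega> \<in> space M. d n \<omega> > ennreal \<epsilon>}) \<longlonglongrightarrow> 0)"

text \<open>
  \<open>has_ito_integral M F B t \<phi> Y\<close>: the integral of \<open>\<phi>\<close> over $[0,t]$ with respect to \<open>B\<close> is well-defined
  and almost surely equal to \<open>Y\<close>. It is the limit in probability of the integrals of simple
  processes that approximate \<open>\<phi>\<close> in $L^2[0,t]$, in probability.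
\<close>

definition has_ito_integral ::
  "'a measure \<Rightarrow> (real \<Rightarrow> 'a measure) \<Rightarrow> (real \<Rightarrow> 'a \<Rightarrow> real) \<Rightarrow> real
    \<Rightarrow> (real \<Rightarrow> 'a \<Rightarrow> real) \<Rightarrow> ('a \<Rightarrow> real) \<Rightarrow> bool" where
  "has_ito_integral M F B t \<phi> Y \<longleftrightarrow>
     Y \<in> borel_measurable M \<and>
     (\<exists>\<psi> k \<tau> \<xi>.
        ito_integrand_version M F t \<phi> \<psi> \<and>
        (\<forall>n. simple_process_data M F t (k n) (\<tau> n) (\<xi> n)) \<and>
        null_in_prob M (\<lambda>n \<omega>. \<integral>\<^sup>+s\<in>{0..t}.
            ennreal ((simple_process (k n) (\<tau> n) (\<xi> n) s \<omega> - \<psi> s \<omega>)\<^sup>2) \<partial>lborel) \<and>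
        null_in_prob M (\<lambda>n \<omega>. ennreal \<bar>simple_integral B (k n) (\<tau> n) (\<xi> n) \<omega> - Y \<omega>\<bar>))"

section \<open>Responsive fractional Brownian motion\<close>

definition lipschitz_hoelder_response :: "real \<Rightarrow> (real \<Rightarrow> real \<Rightarrow> real) \<Rightarrow> bool" where
  "lipschitz_hoelder_response T H \<longleftrightarrow>
     (\<exists>L C \<gamma> hmin hmax. L > 0 \<and> C > 0 \<and> 0 < \<gamma> \<and> \<gamma> \<le> 1 \<and> 0 < hmin \<and> hmin \<le> hmax \<and> hmax < 1 \<and>
        (\<forall>t\<in>{0..T}. \<forall>x y. \<bar>H t x - H t y\<bar> \<le> L * \<bar>x - y\<bar>) \<and>
        (\<forall>t\<in>{0..T}. \<forall>s\<in>{0..T}. \<forall>x. \<bar>H t x - H s x\<bar> \<le> C * \<bar>t - s\<bar> powr \<gamma>) \<and>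
        (\<forall>t\<in>{0..T}. \<forall>x. hmin \<le> H t x \<and> H t x \<le> hmax))"

text \<open>
  The kernel is meant for \<open>s < t\<close>. At \<open>s = t\<close> its value here is 0, since \<open>0 powr a = 0\<close> even for
  \<open>a = 0\<close>; no integral below depends on it.
\<close>

definition rfbm_kernel :: "(real \<Rightarrow> real \<Rightarrow> real) \<Rightarrow> real \<Rightarrow> real \<Rightarrow> real \<Rightarrow> real" where
  "rfbm_kernel H t s x = sqrt (2 * H s x) * (t - s) powr (H s x - 1/2)"

definition responsive_fbm ::
  "'a measure \<Rightarrow> (real \<Rightarrow> 'a measure) \<Rightarrow> real \<Rightarrow> (real \<Rightarrow> 'a \<Rightarrow> real) \<Rightarrow> (real \<Rightarrow> real \<Rightarrow> real)
    \<Rightarrow> (real \<Rightarrow> 'a \<Rightarrow> real) \<Rightarrow> bool" where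
  "responsive_fbm M F T B H X \<longleftrightarrow>
     usual_filtered_prob_space M F T \<and>
     brownian_motion M F T B \<and>
     adapted_process F T X \<and>
     (AE \<omega> in M. continuous_on {0..T} (\<lambda>t. X t \<omega>)) \<and>
     (\<forall>t\<in>{0..T}. has_ito_integral M F B t (\<lambda>s \<omega>. rfbm_kernel H t s (X s \<omega>)) (X t))"

text \<open>The argument \<open>x\<close> is a single path.\<close>

definition attention_normalizer :: "(real \<Rightarrow> real \<Rightarrow> real) \<Rightarrow> real \<Rightarrow> (real \<Rightarrow> real) \<Rightarrow> real" where
  "attention_normalizer H t x = (LBINT u:{0..<t}. rfbm_kernel H t u (x u))"

definition attention_weight :: "(real \<Rightarrow> real \<Rightarrow> real) \<Rightarrow> real \<Rightarrow> (real \<Rightarrow> real) \<Rightarrow> real \<Rightarrow> real" where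
  "attention_weight H t x s = rfbm_kernel H t s (x s) / attention_normalizer H t x"

definition in_Linfty_on :: "real set \<Rightarrow> (real \<Rightarrow> real) \<Rightarrow> bool" where
  "in_Linfty_on S f \<longleftrightarrow>
     set_borel_measurable lborel S f \<and> (\<exists>C. AE s in lborel. s \<in> S \<longrightarrow> \<bar>f s\<bar> \<le> C)"

end

theory Submission
  imports Defs "HOL-Real_Asymp.Real_Asymp"
begin

text \<open>
  Fix \<open>t\<close> and a continuous path \<open>x\<close>, and write $e(s) = H(s, x_s)$. The kernel equals
  $\sqrt{2e(s)}\,\exp((e(s) - 1/2)\ln(t - s))$. Since \<open>e\<close> is continuous with values in a compact
  subinterval of $(0,1)$, the kernel is positive and continuous on $[0,t)$ and dominated by an
  integrable power of $t - s$. So the normalizer is positive and finite, and positivity,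
  normalization and continuity of the weights follow. As $\ln(t-s) \to -\infty$, the limit at \<open>t\<close> is
  0 or $+\infty$ when $e(t) > 1/2$ or $e(t) < 1/2$.

  The critical case $e(t) = 1/2$ is the only difficult one: the exponent is then a product of the
  form $0 \cdot \infty$, and one needs $(e(s) - e(t)) \ln (t-s) \to 0$. Continuity of the path does not
  imply this, and the event $H(t, X_t) = 1/2$ may have positive probability. It does follow if \<open>x\<close>
  has a Hoelder modulus of continuity at \<open>t\<close>, of any positive order
  (\<open>hoelder_path.response_log_tendsto\<close>). So a suitable null set is
  one that contains all paths that are not continuous or have no such modulus at \<open>t\<close>.

  That almost every path has one (\<open>rfbm_hoelder_at_left\<close>) is a one-point version of Kolmogorov's
  continuity theorem. The increment $X_t - X_s$ is an Ito integral whose integrand is the difference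
  of the kernels at \<open>t\<close> and \<open>s\<close>. Because \<open>H\<close> takes values in a fixed compact subinterval of $(0,1)$,
  the $L^2$ norm of this difference is bounded by a deterministic power of $t - s$
  (\<open>rfbm_kernel_increment_L2\<close>). An Ito integral whose integrand has deterministically bounded square
  integral has Gaussian tails: for simple integrands because the stochastic exponential has
  expectation 1 (\<open>simple_integral_tail\<close>), and in general by passing to the limit in probability
  (\<open>ito_difference_tail\<close>). Gaussian tails make the exceptional probabilities summable over the dyadic
  grids of $[0,t]$, and a chaining argument towards \<open>t\<close> (\<open>hoelder_at_right_endpoint\<close>) concludes.
\<close>

section \<open>Exponential martingales of simple integrals\<close>

text \<open>
  Completing the square turns the weighted density into the density of the Gaussian with mean
  \<open>\<eta> * v\<close> and the same variance.
\<close>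

lemma nn_integral_gaussian_exponential:
  fixes \<eta> v :: real
  assumes "v > 0"
  shows "(\<integral>\<^sup>+x. ennreal (exp (\<eta> * x - \<eta>\<^sup>2 * v / 2)) * ennreal (normal_density 0 (sqrt v) x) \<partial>lborel) = 1"
proof -
  have "exp (\<eta> * x - \<eta>\<^sup>2 * v / 2) * normal_density 0 (sqrt v) x = normal_density (\<eta> * v) (sqrt v) x" for x
  proof -
    have "\<eta> * x - \<eta>\<^sup>2 * v / 2 - x\<^sup>2 / (2 * v) = - (x - \<eta> * v)\<^sup>2 / (2 * v)"
      using assms by (simp add: field_simps power2_eq_square)
    then show ?thesis
      using assms by (simp add: normal_density_def exp_diff[symmetric] exp_add[symmetric] algebra_simps)
  qed
  then have "(\<integral>\<^sup>+x. ennreal (exp (\<eta> * x - \<eta>\<^sup>2 * v / 2)) * ennreal (normal_density 0 (sqrt v) x) \<partial>lborel)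
      = (\<integral>\<^sup>+x. ennreal (normal_density (\<eta> * v) (sqrt v) x) \<partial>lborel)"
    by (simp add: ennreal_mult[symmetric])
  also have "\<dots> = 1"
    using assms by (subst nn_integral_eq_integral) auto
  finally show ?thesis .
qed

context usual_filtered_prob_space
begin

lemma space_F: "u \<in> {0..T} \<Longrightarrow> space (F u) = space M"
  using subalgebra_F[of u] by (simp add: subalgebra_def)

lemma measurable_F_imp_M: "u \<in> {0..T} \<Longrightarrow> f \<in> borel_measurable (F u) \<Longrightarrow> f \<in> borel_measurable M"
  using measurable_from_subalg[OF subalgebra_F] by blast

lemma measurable_F_mono:
  assumes "0 \<le> s" "s \<le> u" "u \<le> T" "f \<in> borel_measurable (F s)"
  shows "f \<in> borel_measurable (F u)"
proof -
  have "subalgebra (F u) (F s)"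
    using assms F_mono[of s u] by (simp add: subalgebra_def space_F)
  then show ?thesis using assms(4) by (rule measurable_from_subalg)
qed

text \<open>
  The increment of \<open>B\<close> over \<open>[s, t]\<close> is independent of \<open>F s\<close>. By Fubini, \<open>W\<close> and \<open>\<eta>\<close> can be held fixed while
  the increment is integrated out, and the compensator normalizes that Gaussian integral to 1.
\<close>

lemma exponential_step:
  assumes B: "brownian_motion M F T B"
    and st: "0 \<le> s" "s \<le> t" "t \<le> T"
    and W [measurable]: "W \<in> borel_measurable (F s)" and \<eta> [measurable]: "\<eta> \<in> borel_measurable (F s)"
  shows "(\<integral>\<^sup>+\<omega>. ennreal (exp (W \<omega> + (\<eta> \<omega> * (B t \<omega> - B s \<omega>) - (\<eta> \<omega>)\<^sup>2 * (t - s) / 2))) \<partial>M)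
    = (\<integral>\<^sup>+\<omega>. ennreal (exp (W \<omega>)) \<partial>M)"
proof (cases "s = t")
  case True
  then show ?thesis by simp
next
  case False
  then have lt: "s < t" using st by simp
  let ?D = "\<lambda>\<omega>. B t \<omega> - B s \<omega>"
  have sI: "s \<in> {0..T}" using st by simp
  have dist: "distributed M lborel ?D (normal_density 0 (sqrt (t - s)))"
    and ind: "indep_set (sets (F s)) (sets (vimage_algebra (space M) ?D borel))"
    using B st lt unfolding brownian_motion_def by auto
  have D [measurable]: "?D \<in> borel_measurable M"
    using distributed_measurable[OF dist] by simp
  have id [measurable]: "(\<lambda>\<omega>. \<omega>) \<in> measurable M (F s)"
    using subalgebra_F[OF sI] by (auto simp: subalgebra_def measurable_def)
  interpret D: prob_space "distr M borel ?D" by (rule prob_space_distr) simp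
  interpret I: prob_space "distr M (F s) (\<lambda>\<omega>. \<omega>)" by (rule prob_space_distr) simp
  \<comment> \<open>Independence in the form of a product law; the identity map carries all of \<open>F s\<close>.\<close>
  have joint: "distr M (F s) (\<lambda>\<omega>. \<omega>) \<Otimes>\<^sub>M distr M borel ?D
      = distr M (F s \<Otimes>\<^sub>M borel) (\<lambda>\<omega>. (\<omega>, ?D \<omega>))"
  proof (rule pair_measure_eqI)
    fix A S assume A: "A \<in> sets (distr M (F s) (\<lambda>\<omega>. \<omega>))" and S: "S \<in> sets (distr M borel ?D)"
    then have [measurable]: "A \<in> sets (F s)" "S \<in> sets borel" by auto
    have 1: "A \<inter> space M = A"
      using sets.sets_into_space[of A "F s"] by (auto simp: space_F[OF sI])
    have 2: "(\<lambda>\<omega>. (\<omega>, ?D \<omega>)) -` (A \<times> S) \<inter> space M = A \<inter> (?D -` S \<inter> space M)"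
      by auto
    have "?D -` S \<inter> space M \<in> sets (vimage_algebra (space M) ?D borel)"
      by (auto simp: in_vimage_algebra)
    then have "prob (A \<inter> (?D -` S \<inter> space M)) = prob A * prob (?D -` S \<inter> space M)"
      by (intro indep_setD[OF ind]) auto
    then show "emeasure (distr M (F s) (\<lambda>\<omega>. \<omega>)) A * emeasure (distr M borel ?D) S
        = emeasure (distr M (F s \<Otimes>\<^sub>M borel) (\<lambda>\<omega>. (\<omega>, ?D \<omega>))) (A \<times> S)"
      by (simp add: emeasure_distr 1 2 emeasure_eq_measure ennreal_mult)
  qed (simp_all add: D.sigma_finite_measure_axioms I.sigma_finite_measure_axioms
        cong: sets_pair_measure_cong)
  let ?g = "\<lambda>\<omega> x. ennreal (exp (W \<omega> + (\<eta> \<omega> * x - (\<eta> \<omega>)\<^sup>2 * (t - s) / 2)))"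
  have gm: "(\<lambda>(\<omega>, x). ?g \<omega> x) \<in> borel_measurable (F s \<Otimes>\<^sub>M borel)"
    by measurable
  have "(\<integral>\<^sup>+\<omega>. ?g \<omega> (?D \<omega>) \<partial>M)
      = (\<integral>\<^sup>+z. (case z of (\<omega>, x) \<Rightarrow> ?g \<omega> x) \<partial>distr M (F s \<Otimes>\<^sub>M borel) (\<lambda>\<omega>. (\<omega>, ?D \<omega>)))"
    by (subst nn_integral_distr) auto
  also have "\<dots> = (\<integral>\<^sup>+\<omega>. \<integral>\<^sup>+x. ?g \<omega> x \<partial>distr M borel ?D \<partial>distr M (F s) (\<lambda>\<omega>. \<omega>))"
    unfolding joint[symmetric]
    by (subst D.nn_integral_fst[symmetric]) (use gm in \<open>auto cong: measurable_cong_sets\<close>)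
  also have "\<dots> = (\<integral>\<^sup>+\<omega>. ennreal (exp (W \<omega>)) \<partial>distr M (F s) (\<lambda>\<omega>. \<omega>))"
  proof (rule nn_integral_cong)
    fix \<omega>
    have "(\<integral>\<^sup>+x. ?g \<omega> x \<partial>distr M borel ?D) = (\<integral>\<^sup>+x. ?g \<omega> x \<partial>distr M lborel ?D)"
      by (simp add: nn_integral_distr)
    also have "\<dots> = (\<integral>\<^sup>+x. ennreal (normal_density 0 (sqrt (t - s)) x) * ?g \<omega> x \<partial>lborel)"
      unfolding distributed_distr_eq_density[OF dist] by (subst nn_integral_density) auto
    also have "\<dots> = (\<integral>\<^sup>+x. ennreal (exp (W \<omega>)) * (ennreal (exp (\<eta> \<omega> * x - (\<eta> \<omega>)\<^sup>2 * (t - s) / 2))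
         * ennreal (normal_density 0 (sqrt (t - s)) x)) \<partial>lborel)"
      by (intro nn_integral_cong) (simp add: exp_add ennreal_mult mult_ac)
    also have "\<dots> = ennreal (exp (W \<omega>))"
      using lt by (subst nn_integral_cmult) (auto simp: nn_integral_gaussian_exponential)
    finally show "(\<integral>\<^sup>+x. ?g \<omega> x \<partial>distr M borel ?D) = ennreal (exp (W \<omega>))" .
  qed
  also have "\<dots> = (\<integral>\<^sup>+\<omega>. ennreal (exp (W \<omega>)) \<partial>M)"
    by (subst nn_integral_distr) auto
  finally show ?thesis .
qed

lemma brownian_measurable:
  "brownian_motion M F T B \<Longrightarrow> u \<in> {0..T} \<Longrightarrow> B u \<in> borel_measurable (F u)"
  by (simp add: brownian_motion_def adapted_process_def)

text \<open>
  Dropping the last interval of the partition does not change the expectation, so it equals that of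
  the empty sum.
\<close>

lemma simple_integral_exponential_martingale:
  assumes B: "brownian_motion M F T B" and S: "simple_process_data M F t k \<tau> \<xi>" and tT: "t \<le> T"
  shows "(\<integral>\<^sup>+\<omega>. ennreal (exp (\<theta> * simple_integral B k \<tau> \<xi> \<omega>
      - \<theta>\<^sup>2 / 2 * (\<Sum>i<k. (\<xi> i \<omega>)\<^sup>2 * (\<tau> (Suc i) - \<tau> i)))) \<partial>M) = 1"
proof -
  let ?W = "\<lambda>n \<omega>. \<theta> * simple_integral B n \<tau> \<xi> \<omega> - \<theta>\<^sup>2 / 2 * (\<Sum>i<n. (\<xi> i \<omega>)\<^sup>2 * (\<tau> (Suc i) - \<tau> i))"
  have \<tau>: "0 \<le> \<tau> i" "\<tau> i \<le> \<tau> (Suc i)" "\<tau> (Suc i) \<le> T" "\<xi> i \<in> borel_measurable (F (\<tau> i))"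
    if "i < k" for i
    using S that tT unfolding simple_process_data_def by force+
  have "n \<le> k \<Longrightarrow> (n < k \<longrightarrow> ?W n \<in> borel_measurable (F (\<tau> n)))
      \<and> (\<integral>\<^sup>+\<omega>. ennreal (exp (?W n \<omega>)) \<partial>M) = 1" for n
  proof (induction n)
    case 0
    then show ?case by (simp add: simple_integral_def emeasure_space_1)
  next
    case (Suc n)
    then have n: "n < k" by simp
    have W: "?W n \<in> borel_measurable (F (\<tau> n))" and one: "(\<integral>\<^sup>+\<omega>. ennreal (exp (?W n \<omega>)) \<partial>M) = 1"
      using Suc by auto
    note t = \<tau>[OF n]
    have eq: "?W (Suc n) = (\<lambda>\<omega>. ?W n \<omega> + ((\<theta> * \<xi> n \<omega>) * (B (\<tau> (Suc n)) \<omega> - B (\<tau> n) \<omega>)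
        - (\<theta> * \<xi> n \<omega>)\<^sup>2 * (\<tau> (Suc n) - \<tau> n) / 2))"
    proof
      fix \<omega>
      have *: "\<theta> * (a + x * d) - \<theta>\<^sup>2 / 2 * (b + x\<^sup>2 * e)
          = \<theta> * a - \<theta>\<^sup>2 / 2 * b + (\<theta> * x * d - (\<theta> * x)\<^sup>2 * e / 2)" for a b x d e :: real
        by (simp add: power_mult_distrib algebra_simps)
      show "?W (Suc n) \<omega> = ?W n \<omega> + ((\<theta> * \<xi> n \<omega>) * (B (\<tau> (Suc n)) \<omega> - B (\<tau> n) \<omega>)
        - (\<theta> * \<xi> n \<omega>)\<^sup>2 * (\<tau> (Suc n) - \<tau> n) / 2)"
        unfolding simple_integral_def sum.lessThan_Suc by (rule *)
    qed
    have "?W (Suc n) \<in> borel_measurable (F (\<tau> (Suc n)))"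
    proof -
      have m: "f \<in> borel_measurable (F (\<tau> n)) \<Longrightarrow> f \<in> borel_measurable (F (\<tau> (Suc n)))"
        for f :: "'a \<Rightarrow> real"
        by (rule measurable_F_mono[OF t(1-3)])
      have [measurable]: "?W n \<in> borel_measurable (F (\<tau> (Suc n)))" by (rule m[OF W])
      have [measurable]: "\<xi> n \<in> borel_measurable (F (\<tau> (Suc n)))" by (rule m[OF t(4)])
      have [measurable]: "B (\<tau> n) \<in> borel_measurable (F (\<tau> (Suc n)))"
        by (rule m[OF brownian_measurable[OF B]]) (use t in auto)
      have [measurable]: "B (\<tau> (Suc n)) \<in> borel_measurable (F (\<tau> (Suc n)))"
        by (rule brownian_measurable[OF B]) (use t in auto)
      show ?thesis unfolding eq by measurable
    qed
    moreover have "(\<integral>\<^sup>+\<omega>. ennreal (exp (?W (Suc n) \<omega>)) \<partial>M) = 1"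
      unfolding fun_cong[OF eq]
        exponential_step[OF B t(1-3) W borel_measurable_times[OF borel_measurable_const t(4)]]
      by (rule one)
    ultimately show ?case by blast
  qed
  from this[of k] show ?thesis by simp
qed

end

section \<open>Gaussian tails of simple integrals\<close>

lemma finite_real_set_enumeration:
  fixes P :: "real set"
  assumes "finite P"
  obtains N :: nat and p where "\<And>i j. i < j \<Longrightarrow> j < N \<Longrightarrow> p i < p j" "p ` {..<N} = P"
proof -
  let ?l = "sorted_list_of_set P"
  show thesis
  proof (rule that[of "card P" "(!) ?l"])
    show "?l ! i < ?l ! j" if "i < j" "j < card P" for i j
      using that assms sorted_wrt_nth_less[of "(<)" ?l i j] by simp
    have "(!) ?l ` {..<length ?l} = set ?l"
      by (auto simp: set_conv_nth)
    then show "(!) ?l ` {..<card P} = P"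
      using assms by simp
  qed
qed

text \<open>
  The cells of a finer grid that end inside \<open>{u<..v}\<close> are exactly those between the indices of \<open>u\<close> and \<open>v\<close>.
\<close>

lemma increments_telescope_over_refinement:
  fixes p :: "nat \<Rightarrow> real" and f :: "real \<Rightarrow> real"
  assumes mono: "\<And>i j. i < j \<Longrightarrow> j \<le> N \<Longrightarrow> p i < p j"
    and u: "u \<in> p ` {..N}" and v: "v \<in> p ` {..N}" and "u \<le> v"
  shows "f v - f u = (\<Sum>j<N. indicator {u<..v} (p (Suc j)) * (f (p (Suc j)) - f (p j)))"
proof -
  obtain a b where ab: "u = p a" "v = p b" "a \<le> N" "b \<le> N" using u v by auto
  have le: "i \<le> N \<Longrightarrow> j \<le> N \<Longrightarrow> p i < p j \<longleftrightarrow> i < j" for i j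
    using mono by (metis linorder_neqE_nat order_less_asym less_irrefl)
  have "a \<le> b" using ab \<open>u \<le> v\<close> le[of b a] by force
  have "(\<Sum>j<N. indicator {u<..v} (p (Suc j)) * (f (p (Suc j)) - f (p j)))
      = (\<Sum>j\<in>{a..<b}. f (p (Suc j)) - f (p j))"
  proof (rule sum.mono_neutral_cong_right)
    show "{a..<b} \<subseteq> {..<N}" using ab by auto
    have iff: "p (Suc j) \<in> {u<..v} \<longleftrightarrow> j \<in> {a..<b}" if "j < N" for j
      using le[of a "Suc j"] le[of b "Suc j"] ab that by (auto simp: not_less)
    show "\<forall>j\<in>{..<N} - {a..<b}. indicator {u<..v} (p (Suc j)) * (f (p (Suc j)) - f (p j)) = 0"
      using iff by (auto simp: indicator_def)
    show "indicator {u<..v} (p (Suc j)) * (f (p (Suc j)) - f (p j)) = f (p (Suc j)) - f (p j)"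
      if "j \<in> {a..<b}" for j
      using iff[of j] that ab by (auto simp: indicator_def)
  qed simp
  also have "\<dots> = f v - f u"
    unfolding ab using sum_Suc_diff'[OF \<open>a \<le> b\<close>, of "\<lambda>j. f (p j)"] by simp
  finally show ?thesis ..
qed

text \<open>
  On a cell \<open>{p j<..p (Suc j)}\<close> a simple process is constant, hence equal to its value at the right end
  of the cell; this is the coefficient on the finer grid.
\<close>

lemma simple_process_refine:
  fixes \<xi> :: "nat \<Rightarrow> 'a \<Rightarrow> real" and p \<tau> :: "nat \<Rightarrow> real" and B :: "real \<Rightarrow> 'a \<Rightarrow> real"
  assumes mono: "\<And>i j. i < j \<Longrightarrow> j \<le> N \<Longrightarrow> p i < p j"
    and \<tau>: "\<And>i. i < k \<Longrightarrow> \<tau> i \<in> p ` {..N} \<and> \<tau> (Suc i) \<in> p ` {..N} \<and> \<tau> i \<le> \<tau> (Suc i)"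
  defines "\<eta> \<equiv> \<lambda>j. simple_process k \<tau> \<xi> (p (Suc j))"
  shows "simple_integral B k \<tau> \<xi> \<omega> = simple_integral B N p \<eta> \<omega>"
    and "simple_process k \<tau> \<xi> s \<omega> = simple_process N p \<eta> s \<omega>"
proof -
  have gen: "(\<Sum>i<k. \<xi> i \<omega> * (f (\<tau> (Suc i)) - f (\<tau> i)))
      = (\<Sum>j<N. \<eta> j \<omega> * (f (p (Suc j)) - f (p j)))" for f :: "real \<Rightarrow> real"
  proof -
    have "(\<Sum>i<k. \<xi> i \<omega> * (f (\<tau> (Suc i)) - f (\<tau> i)))
        = (\<Sum>i<k. \<Sum>j<N. \<xi> i \<omega> * (indicator {\<tau> i<..\<tau> (Suc i)} (p (Suc j)) * (f (p (Suc j)) - f (p j))))"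
    proof (rule sum.cong)
      fix i assume "i \<in> {..<k}"
      then have "f (\<tau> (Suc i)) - f (\<tau> i)
          = (\<Sum>j<N. indicator {\<tau> i<..\<tau> (Suc i)} (p (Suc j)) * (f (p (Suc j)) - f (p j)))"
        using \<tau>[of i] by (intro increments_telescope_over_refinement[OF mono]) auto
      then show "\<xi> i \<omega> * (f (\<tau> (Suc i)) - f (\<tau> i))
          = (\<Sum>j<N. \<xi> i \<omega> * (indicator {\<tau> i<..\<tau> (Suc i)} (p (Suc j)) * (f (p (Suc j)) - f (p j))))"
        by (simp only: sum_distrib_left)
    qed simp
    also have "\<dots> = (\<Sum>j<N. \<Sum>i<k. \<xi> i \<omega> * (indicator {\<tau> i<..\<tau> (Suc i)} (p (Suc j)) * (f (p (Suc j)) - f (p j))))"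
      by (rule sum.swap)
    also have "\<dots> = (\<Sum>j<N. \<eta> j \<omega> * (f (p (Suc j)) - f (p j)))"
      unfolding \<eta>_def simple_process_def sum_distrib_right by (simp only: mult.assoc)
    finally show ?thesis .
  qed
  show "simple_integral B k \<tau> \<xi> \<omega> = simple_integral B N p \<eta> \<omega>"
    unfolding simple_integral_def by (rule gen)
  \<comment> \<open>An indicator of a half-open interval is an increment too, of a step function.\<close>
  have ind: "indicator {u<..v} s = (if s \<le> v then 1 else 0 :: real) - (if s \<le> u then 1 else 0)"
    if "u \<le> v" for u v :: real
    using that by (auto simp: indicator_def)
  have p: "p j \<le> p (Suc j)" if "j < N" for j
    using mono[of j "Suc j"] that by simp
  have "simple_process k \<tau> \<xi> s \<omega> = (\<Sum>i<k. \<xi> i \<omega> * ((if s \<le> \<tau> (Suc i) then 1 else 0) - (if s \<le> \<tau> i then 1 else 0)))"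
    unfolding simple_process_def using \<tau> by (intro sum.cong) (auto simp only: ind)
  also have "\<dots> = simple_process N p \<eta> s \<omega>"
    unfolding gen[of "\<lambda>x. if s \<le> x then 1 else 0"] simple_process_def
    using p by (intro sum.cong) (auto simp only: ind lessThan_iff)
  finally show "simple_process k \<tau> \<xi> s \<omega> = simple_process N p \<eta> s \<omega>" .
qed

text \<open>
  The cells are pairwise disjoint, so the square has no cross terms.
\<close>

lemma simple_process_square:
  assumes \<tau>: "\<And>i. i < k \<Longrightarrow> \<tau> i \<le> \<tau> (Suc i)"
  shows "(simple_process k \<tau> \<xi> s \<omega>)\<^sup>2 = (\<Sum>i<k. (\<xi> i \<omega>)\<^sup>2 * indicator {\<tau> i<..\<tau> (Suc i)} s)"
proof -
  have mono: "i \<le> j \<Longrightarrow> j \<le> k \<Longrightarrow> \<tau> i \<le> \<tau> j" for i j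
  proof (induction rule: dec_induct)
    case (step n) then show ?case using \<tau>[of n] by simp
  qed simp
  show ?thesis
  proof (cases "\<exists>i<k. s \<in> {\<tau> i<..\<tau> (Suc i)}")
    case True
    then obtain i where i: "i < k" "s \<in> {\<tau> i<..\<tau> (Suc i)}" by blast
    have other: "s \<notin> {\<tau> j<..\<tau> (Suc j)}" if "j < k" "j \<noteq> i" for j
      using mono[of "Suc i" j] mono[of "Suc j" i] i that by (cases "i < j") auto
    have *: "(\<Sum>j<k. g j * indicator {\<tau> j<..\<tau> (Suc j)} s) = g i" for g :: "nat \<Rightarrow> real"
    proof -
      have "(\<Sum>j<k. g j * indicator {\<tau> j<..\<tau> (Suc j)} s) = (\<Sum>j<k. if j = i then g i else 0)"
        using i other by (intro sum.cong) (auto simp: indicator_def)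
      then show ?thesis using i by simp
    qed
    show ?thesis unfolding simple_process_def * by simp
  next
    case False
    have "(\<Sum>j<k. g j * indicator {\<tau> j<..\<tau> (Suc j)} s) = 0" for g :: "nat \<Rightarrow> real"
      using False by (intro sum.neutral) auto
    then show ?thesis unfolding simple_process_def by simp
  qed
qed

lemma nn_integral_simple_process_square:
  assumes S: "simple_process_data M F t k \<tau> \<xi>"
  shows "(\<integral>\<^sup>+s\<in>{0..t}. ennreal ((simple_process k \<tau> \<xi> s \<omega>)\<^sup>2) \<partial>lborel)
    = ennreal (\<Sum>i<k. (\<xi> i \<omega>)\<^sup>2 * (\<tau> (Suc i) - \<tau> i))"
proof -
  have \<tau>: "0 \<le> \<tau> i" "\<tau> i \<le> \<tau> (Suc i)" "\<tau> (Suc i) \<le> t" if "i < k" for i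
    using S that unfolding simple_process_data_def by auto
  have "ennreal ((simple_process k \<tau> \<xi> s \<omega>)\<^sup>2) * indicator {0..t} s
      = (\<Sum>i<k. ennreal ((\<xi> i \<omega>)\<^sup>2) * indicator {\<tau> i<..\<tau> (Suc i)} s)" for s
  proof -
    have sq: "(simple_process k \<tau> \<xi> s \<omega>)\<^sup>2 = (\<Sum>i<k. (\<xi> i \<omega>)\<^sup>2 * indicator {\<tau> i<..\<tau> (Suc i)} s)"
      by (rule simple_process_square) (rule \<tau>(2))
    have "(simple_process k \<tau> \<xi> s \<omega>)\<^sup>2 * indicator {0..t} s = (\<Sum>i<k. (\<xi> i \<omega>)\<^sup>2 * indicator {\<tau> i<..\<tau> (Suc i)} s)"
      unfolding sq sum_distrib_right
      using \<tau> by (intro sum.cong) (force simp: indicator_def)+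
    moreover have "ennreal ((simple_process k \<tau> \<xi> s \<omega>)\<^sup>2) * indicator {0..t} s
      = ennreal ((simple_process k \<tau> \<xi> s \<omega>)\<^sup>2 * indicator {0..t} s)"
      by (simp add: indicator_def)
    moreover have "(\<Sum>i<k. ennreal ((\<xi> i \<omega>)\<^sup>2) * indicator {\<tau> i<..\<tau> (Suc i)} s)
      = ennreal (\<Sum>i<k. (\<xi> i \<omega>)\<^sup>2 * indicator {\<tau> i<..\<tau> (Suc i)} s)"
      by (subst sum_ennreal[symmetric]) (auto simp: ennreal_mult ennreal_indicator)
    ultimately show ?thesis by simp
  qed
  then have "(\<integral>\<^sup>+s\<in>{0..t}. ennreal ((simple_process k \<tau> \<xi> s \<omega>)\<^sup>2) \<partial>lborel)
      = (\<integral>\<^sup>+s. (\<Sum>i<k. ennreal ((\<xi> i \<omega>)\<^sup>2) * indicator {\<tau> i<..\<tau> (Suc i)} s) \<partial>lborel)"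
    by simp
  also have "\<dots> = (\<Sum>i<k. ennreal ((\<xi> i \<omega>)\<^sup>2) * ennreal (\<tau> (Suc i) - \<tau> i))"
    by (subst nn_integral_sum) (auto simp: nn_integral_cmult_indicator \<tau>)
  also have "\<dots> = ennreal (\<Sum>i<k. (\<xi> i \<omega>)\<^sup>2 * (\<tau> (Suc i) - \<tau> i))"
    using \<tau> by (subst sum_ennreal[symmetric]) (auto simp: ennreal_mult)
  finally show ?thesis .
qed

context usual_filtered_prob_space
begin

text \<open>
  The time \<open>r\<close> may precede \<open>s\<close>: predictability only requires \<open>r\<close> not to precede the left end of the cell
  that contains \<open>s\<close>.
\<close>

lemma simple_process_measurable:
  assumes S: "simple_process_data M F t k \<tau> \<xi>" and "r \<in> {0..T}"
    and r: "\<And>i. i < k \<Longrightarrow> s \<in> {\<tau> i<..\<tau> (Suc i)} \<Longrightarrow> \<tau> i \<le> r"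
  shows "simple_process k \<tau> \<xi> s \<in> borel_measurable (F r)"
proof -
  have "(\<lambda>\<omega>. \<xi> i \<omega> * indicator {\<tau> i<..\<tau> (Suc i)} s) \<in> borel_measurable (F r)" if i: "i < k" for i
  proof (cases "s \<in> {\<tau> i<..\<tau> (Suc i)}")
    case True
    have "\<xi> i \<in> borel_measurable (F (\<tau> i))" "0 \<le> \<tau> i"
      using S i unfolding simple_process_data_def by auto
    then have "\<xi> i \<in> borel_measurable (F r)"
      using measurable_F_mono[of "\<tau> i" r "\<xi> i"] r[OF i True] assms(2) by simp
    then show ?thesis by simp
  next
    case False then show ?thesis by simp
  qed
  then show ?thesis
    unfolding simple_process_def[abs_def] by (intro borel_measurable_sum) auto
qed

lemma simple_process_bounded:
  assumes "simple_process_data M F t k \<tau> \<xi>"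
  shows "\<exists>C. \<forall>\<omega>\<in>space M. \<bar>simple_process k \<tau> \<xi> s \<omega>\<bar> \<le> C"
proof -
  obtain C where C: "\<And>i \<omega>. i < k \<Longrightarrow> \<omega> \<in> space M \<Longrightarrow> \<bar>\<xi> i \<omega>\<bar> \<le> C i"
    using assms unfolding simple_process_data_def by metis
  have "\<bar>simple_process k \<tau> \<xi> s \<omega>\<bar> \<le> (\<Sum>i<k. C i)" if "\<omega> \<in> space M" for \<omega>
    unfolding simple_process_def
    by (rule order_trans[OF sum_abs], rule sum_mono)
      (use C[OF _ that] in \<open>force simp: abs_mult indicator_def intro: order_trans[OF abs_ge_zero]\<close>)
  then show ?thesis by blast
qed

text \<open>
  The difference of two simple processes lives on the common refinement of their partitions. It is
  needed because an increment of $X$ is the difference of integrals of two different integrands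
  over two different time intervals, each with its own approximating partitions.
\<close>

lemma simple_process_diff:
  assumes S1: "simple_process_data M F t k1 \<tau>1 \<xi>1" and S2: "simple_process_data M F t k2 \<tau>2 \<xi>2"
    and t: "0 \<le> t" "t \<le> T"
  shows "\<exists>N p \<eta>. simple_process_data M F t N p \<eta> \<and>
    (\<forall>\<omega>. simple_integral B N p \<eta> \<omega> = simple_integral B k1 \<tau>1 \<xi>1 \<omega> - simple_integral B k2 \<tau>2 \<xi>2 \<omega>) \<and>
    (\<forall>s \<omega>. simple_process N p \<eta> s \<omega> = simple_process k1 \<tau>1 \<xi>1 s \<omega> - simple_process k2 \<tau>2 \<xi>2 s \<omega>)"
proof -
  let ?pts = "\<lambda>k \<tau>. (\<Union>i<k. {\<tau> i, \<tau> (Suc i)}) :: real set"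
  let ?P = "insert 0 (?pts k1 \<tau>1 \<union> ?pts k2 \<tau>2)"
  have fin: "finite ?P" by simp
  obtain N' :: nat and p where mono': "\<And>i j. i < j \<Longrightarrow> j < N' \<Longrightarrow> p i < (p j :: real)" and P': "p ` {..<N'} = ?P"
    using finite_real_set_enumeration[OF fin] by blast
  define N where "N = N' - 1"
  have "N' \<noteq> 0" using P' by (cases "N' = 0") auto
  then have N': "{..<N'} = {..N}" "\<And>j. j < N' \<longleftrightarrow> j \<le> N" by (auto simp: N_def)
  have mono: "i < j \<Longrightarrow> j \<le> N \<Longrightarrow> p i < p j" for i j using mono'[of i j] N' by simp
  have P: "p ` {..N} = ?P" using P' N' by simp
  have bnd: "u \<in> {0..t}" if "u \<in> ?P" for u
    using that S1 S2 t unfolding simple_process_data_def by force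
  then have p_bnd: "p i \<in> {0..t}" if "i \<le> N" for i using P that by blast
  have le: "i \<le> N \<Longrightarrow> j \<le> N \<Longrightarrow> p i < p j \<longleftrightarrow> i < j" for i j
    using mono by (metis linorder_neqE_nat order_less_asym less_irrefl)
  define \<eta> where "\<eta> = (\<lambda>k \<tau> \<xi> j. simple_process k \<tau> \<xi> (p (Suc j)) :: 'a \<Rightarrow> real)"
  have key: "simple_integral B k \<tau> \<xi> \<omega> = simple_integral B N p (\<eta> k \<tau> \<xi>) \<omega>"
      "simple_process k \<tau> \<xi> s \<omega> = simple_process N p (\<eta> k \<tau> \<xi>) s \<omega>"
      "j < N \<Longrightarrow> \<eta> k \<tau> \<xi> j \<in> borel_measurable (F (p j))"
      "\<exists>C. \<forall>\<omega>\<in>space M. \<bar>\<eta> k \<tau> \<xi> j \<omega>\<bar> \<le> C"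
    if S: "simple_process_data M F t k \<tau> \<xi>" and sub: "?pts k \<tau> \<subseteq> ?P" for k \<tau> \<xi> s \<omega> j
  proof -
    have \<tau>: "\<tau> i \<in> p ` {..N} \<and> \<tau> (Suc i) \<in> p ` {..N} \<and> \<tau> i \<le> \<tau> (Suc i)" if "i < k" for i
      using sub that S unfolding P simple_process_data_def by auto
    show "simple_integral B k \<tau> \<xi> \<omega> = simple_integral B N p (\<eta> k \<tau> \<xi>) \<omega>"
      "simple_process k \<tau> \<xi> s \<omega> = simple_process N p (\<eta> k \<tau> \<xi>) s \<omega>"
      unfolding \<eta>_def
      by (rule simple_process_refine(1), erule (1) mono, erule \<tau>)
        (rule simple_process_refine(2), erule (1) mono, erule \<tau>)
    show "\<exists>C. \<forall>\<omega>\<in>space M. \<bar>\<eta> k \<tau> \<xi> j \<omega>\<bar> \<le> C"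
      unfolding \<eta>_def by (rule simple_process_bounded[OF S])
    show "\<eta> k \<tau> \<xi> j \<in> borel_measurable (F (p j))" if "j < N"
      unfolding \<eta>_def
    proof (rule simple_process_measurable[OF S])
      show "p j \<in> {0..T}" using p_bnd[of j] that t by simp
      \<comment> \<open>No point of the refined grid lies strictly between \<open>p j\<close> and \<open>p (Suc j)\<close>.\<close>
      fix i assume "i < k" and s: "p (Suc j) \<in> {\<tau> i<..\<tau> (Suc i)}"
      then obtain a where a: "\<tau> i = p a" "a \<le> N" using \<tau>[of i] by auto
      then show "\<tau> i \<le> p j"
        using s le[of a "Suc j"] le[of j a] that by auto
    qed
  qed
  note key1 = key[OF S1] and key2 = key[OF S2]
  have sub: "?pts k1 \<tau>1 \<subseteq> ?P" "?pts k2 \<tau>2 \<subseteq> ?P" by auto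
  show ?thesis
  proof (intro exI conjI allI)
    let ?\<eta> = "\<lambda>j \<omega>. \<eta> k1 \<tau>1 \<xi>1 j \<omega> - \<eta> k2 \<tau>2 \<xi>2 j \<omega>"
    show "simple_process_data M F t N p ?\<eta>"
      unfolding simple_process_data_def
    proof (intro allI impI conjI)
      fix j assume j: "j < N"
      show "0 \<le> p j" "p j \<le> p (Suc j)" "p (Suc j) \<le> t"
        using p_bnd[of j] p_bnd[of "Suc j"] mono[of j "Suc j"] j by auto
      show "?\<eta> j \<in> borel_measurable (F (p j))"
        by (rule borel_measurable_diff[OF key1(3)[OF sub(1) j] key2(3)[OF sub(2) j]])
      obtain C1 C2 where "\<forall>\<omega>\<in>space M. \<bar>\<eta> k1 \<tau>1 \<xi>1 j \<omega>\<bar> \<le> C1" "\<forall>\<omega>\<in>space M. \<bar>\<eta> k2 \<tau>2 \<xi>2 j \<omega>\<bar> \<le> C2"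
        using key1(4)[OF sub(1)] key2(4)[OF sub(2)] by metis
      then have "\<forall>\<omega>\<in>space M. \<bar>?\<eta> j \<omega>\<bar> \<le> C1 + C2" by force
      then show "\<exists>C. \<forall>\<omega>\<in>space M. \<bar>?\<eta> j \<omega>\<bar> \<le> C" ..
    qed
    show "simple_integral B N p ?\<eta> \<omega> = simple_integral B k1 \<tau>1 \<xi>1 \<omega> - simple_integral B k2 \<tau>2 \<xi>2 \<omega>" for \<omega>
      unfolding key1(1)[OF sub(1), of \<omega>] key2(1)[OF sub(2), of \<omega>]
      by (simp add: simple_integral_def sum_subtractf left_diff_distrib)
    show "simple_process N p ?\<eta> s \<omega> = simple_process k1 \<tau>1 \<xi>1 s \<omega> - simple_process k2 \<tau>2 \<xi>2 s \<omega>" for s \<omega>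
      unfolding key1(2)[OF sub(1), of s \<omega>] key2(2)[OF sub(2), of s \<omega>]
      by (simp add: simple_process_def sum_subtractf left_diff_distrib)
  qed
qed

lemma simple_integral_measurable:
  assumes B: "brownian_motion M F T B" and S: "simple_process_data M F t k \<tau> \<xi>" and "t \<le> T"
  shows "simple_integral B k \<tau> \<xi> \<in> borel_measurable M"
proof -
  have "(\<lambda>\<omega>. \<xi> i \<omega> * (B (\<tau> (Suc i)) \<omega> - B (\<tau> i) \<omega>)) \<in> borel_measurable M" if "i < k" for i
  proof -
    have \<tau>: "\<tau> i \<in> {0..T}" "\<tau> (Suc i) \<in> {0..T}" "\<xi> i \<in> borel_measurable (F (\<tau> i))"
      using S that assms(3) unfolding simple_process_data_def by force+
    show ?thesis
      by (intro borel_measurable_times borel_measurable_diff measurable_F_imp_M[OF \<tau>(1,3)]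
          measurable_F_imp_M[OF \<tau>(1)] measurable_F_imp_M[OF \<tau>(2)] brownian_measurable[OF B] \<tau>)
  qed
  then show ?thesis
    unfolding simple_integral_def[abs_def] by (intro borel_measurable_sum) auto
qed

text \<open>
  Chernoff's method. On the event the exponential martingale is at least $e^{a^2/(2v)}$, while its
  expectation is 1; this is used for the integral and for its negative.
\<close>

lemma simple_integral_tail:
  assumes B: "brownian_motion M F T B" and S: "simple_process_data M F t k \<tau> \<xi>" and tT: "t \<le> T"
    and "a > 0" "v > 0"
  shows "prob {\<omega>\<in>space M. \<bar>simple_integral B k \<tau> \<xi> \<omega>\<bar> > a \<and>
      (\<integral>\<^sup>+s\<in>{0..t}. ennreal ((simple_process k \<tau> \<xi> s \<omega>)\<^sup>2) \<partial>lborel) \<le> ennreal v}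
    \<le> 2 * exp (- (a\<^sup>2 / (2 * v)))"
proof -
  let ?I = "simple_integral B k \<tau> \<xi>"
  let ?Q = "\<lambda>\<omega>. \<Sum>i<k. (\<xi> i \<omega>)\<^sup>2 * (\<tau> (Suc i) - \<tau> i)"
  have I [measurable]: "?I \<in> borel_measurable M" by (rule simple_integral_measurable[OF B S tT])
  have \<tau>: "\<tau> i \<in> {0..T}" "\<xi> i \<in> borel_measurable (F (\<tau> i))" if "i < k" for i
    using S that tT unfolding simple_process_data_def by force+
  have [measurable]: "?Q \<in> borel_measurable M"
    using measurable_F_imp_M[OF \<tau>]
    by (intro borel_measurable_sum borel_measurable_times borel_measurable_power) auto
  have one: "prob {\<omega>\<in>space M. \<epsilon> * ?I \<omega> > a \<and> ?Q \<omega> \<le> v} \<le> exp (- (a\<^sup>2 / (2 * v)))"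
    if \<epsilon>: "\<epsilon>\<^sup>2 = 1" for \<epsilon> :: real
  proof -
    \<comment> \<open>The optimal parameter in Chernoff's bound for a Gaussian of variance \<open>v\<close>.\<close>
    define \<theta> where "\<theta> = \<epsilon> * (a / v)"
    let ?Z = "\<lambda>\<omega>. exp (\<theta> * ?I \<omega> - \<theta>\<^sup>2 / 2 * ?Q \<omega>)"
    let ?A = "{\<omega>\<in>space M. \<epsilon> * ?I \<omega> > a \<and> ?Q \<omega> \<le> v}"
    have \<theta>2: "\<theta>\<^sup>2 = (a / v)\<^sup>2" unfolding \<theta>_def power_mult_distrib[of \<epsilon>] \<epsilon> by simp
    have "ennreal (exp (a\<^sup>2 / (2 * v))) * emeasure M ?A = (\<integral>\<^sup>+\<omega>. ennreal (exp (a\<^sup>2 / (2 * v))) * indicator ?A \<omega> \<partial>M)"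
      by (subst nn_integral_cmult_indicator) auto
    also have "\<dots> \<le> (\<integral>\<^sup>+\<omega>. ennreal (?Z \<omega>) \<partial>M)"
    proof (rule nn_integral_mono)
      fix \<omega>
      have "a\<^sup>2 / (2 * v) \<le> \<theta> * ?I \<omega> - \<theta>\<^sup>2 / 2 * ?Q \<omega>" if "\<omega> \<in> ?A"
      proof -
        have "(a / v) * a \<le> (a / v) * (\<epsilon> * ?I \<omega>)"
          using that assms by (intro mult_left_mono) auto
        moreover have "\<theta>\<^sup>2 / 2 * ?Q \<omega> \<le> \<theta>\<^sup>2 / 2 * v"
          using that by (intro mult_left_mono) auto
        moreover have "a\<^sup>2 / (2 * v) = (a / v) * a - \<theta>\<^sup>2 / 2 * v"
          unfolding \<theta>2 using \<open>v > 0\<close> by (simp add: field_simps power2_eq_square)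
        moreover have "(a / v) * (\<epsilon> * ?I \<omega>) = \<theta> * ?I \<omega>" by (simp add: \<theta>_def)
        ultimately show ?thesis by linarith
      qed
      then show "ennreal (exp (a\<^sup>2 / (2 * v))) * indicator ?A \<omega> \<le> ennreal (?Z \<omega>)"
        by (auto simp: indicator_def intro!: ennreal_leI)
    qed
    also have "\<dots> = 1" by (rule simple_integral_exponential_martingale[OF B S tT])
    finally have "exp (a\<^sup>2 / (2 * v)) * prob ?A \<le> 1"
      by (simp add: emeasure_eq_measure ennreal_mult[symmetric] ennreal_le_1)
    then show ?thesis by (simp add: exp_minus field_simps)
  qed
  have "{\<omega>\<in>space M. \<bar>?I \<omega>\<bar> > a \<and> (\<integral>\<^sup>+s\<in>{0..t}. ennreal ((simple_process k \<tau> \<xi> s \<omega>)\<^sup>2) \<partial>lborel) \<le> ennreal v}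
      \<subseteq> {\<omega>\<in>space M. 1 * ?I \<omega> > a \<and> ?Q \<omega> \<le> v} \<union> {\<omega>\<in>space M. (-1) * ?I \<omega> > a \<and> ?Q \<omega> \<le> v}"
    unfolding nn_integral_simple_process_square[OF S] using \<open>v > 0\<close> by (auto simp: ennreal_le_iff)
  then have "prob {\<omega>\<in>space M. \<bar>?I \<omega>\<bar> > a \<and> (\<integral>\<^sup>+s\<in>{0..t}. ennreal ((simple_process k \<tau> \<xi> s \<omega>)\<^sup>2) \<partial>lborel) \<le> ennreal v}
      \<le> prob ({\<omega>\<in>space M. 1 * ?I \<omega> > a \<and> ?Q \<omega> \<le> v} \<union> {\<omega>\<in>space M. (-1) * ?I \<omega> > a \<and> ?Q \<omega> \<le> v})"
    by (rule finite_measure_mono) measurable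
  also have "\<dots> \<le> prob {\<omega>\<in>space M. 1 * ?I \<omega> > a \<and> ?Q \<omega> \<le> v} + prob {\<omega>\<in>space M. (-1) * ?I \<omega> > a \<and> ?Q \<omega> \<le> v}"
    by (rule measure_Un_le) measurable
  also have "\<dots> \<le> 2 * exp (- (a\<^sup>2 / (2 * v)))"
    using one[of 1] one[of "-1"] by simp
  finally show ?thesis .
qed

end

section \<open>Gaussian tails of Ito integrals\<close>

context usual_filtered_prob_space
begin

lemma progressive_section_measurable:
  assumes "progressive F t \<psi>" "t \<in> {0..T}" "\<omega> \<in> space M"
  shows "(\<lambda>u. indicator {0..t} u * \<psi> u \<omega>) \<in> borel_measurable borel"
proof -
  have m: "(\<lambda>(u, \<omega>). \<psi> u \<omega>) \<in> borel_measurable (restrict_space borel {0..t} \<Otimes>\<^sub>M F t)"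
    using assms unfolding progressive_def by auto
  have "\<omega> \<in> space (F t)" using assms space_F by auto
  then have "(\<lambda>u. \<psi> u \<omega>) \<in> borel_measurable (restrict_space borel {0..t})"
    using measurable_compose[OF measurable_Pair2'[of \<omega> "F t" "restrict_space borel {0..t}"] m]
    by simp
  then show ?thesis
    by (subst (asm) borel_measurable_restrict_space_iff) simp_all
qed

text \<open>
  The error is an inner integral of a jointly measurable function. Convergence in probability is
  stated with \<open>measure\<close>, which is 0 on sets that are not measurable, so only measurability makes
  the union bound over the exceptional events valid.
\<close>

lemma approximation_error_measurable:
  assumes S: "simple_process_data M F t k \<tau> \<xi>" and \<psi>: "progressive F t \<psi>" and t: "t \<in> {0..T}"
  shows "(\<lambda>\<omega>. \<integral>\<^sup>+u\<in>{0..t}. ennreal ((simple_process k \<tau> \<xi> u \<omega> - \<psi> u \<omega>)\<^sup>2) \<partial>lborel) \<in> borel_measurable M"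
proof -
  let ?R = "restrict_space lborel {0..t}"
  interpret R: sigma_finite_measure ?R
    by (rule sigma_finite_measure_restrict_space) (auto intro: sigma_finite_lborel)
  have Rsets: "sets ?R = sets (restrict_space borel {0..t})"
    by (rule sets_restrict_space_cong) simp
  have id: "(\<lambda>\<omega>. \<omega>) \<in> measurable M (F t)"
    using subalgebra_F[OF t] by (auto simp: subalgebra_def measurable_def)
  have "(\<lambda>(u, \<omega>). \<psi> u \<omega>) \<in> borel_measurable (restrict_space borel {0..t} \<Otimes>\<^sub>M F t)"
    using \<psi> t unfolding progressive_def by auto
  then have m0: "(\<lambda>(u, \<omega>). \<psi> u \<omega>) \<in> borel_measurable (?R \<Otimes>\<^sub>M F t)"
    by (simp add: measurable_cong_sets[OF sets_pair_measure_cong[OF Rsets refl] refl])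
  have id2: "(\<lambda>z. (snd z, fst z)) \<in> measurable (M \<Otimes>\<^sub>M ?R) (?R \<Otimes>\<^sub>M F t)"
    by (intro measurable_Pair measurable_snd measurable_compose[OF measurable_fst id])
  have m: "(\<lambda>z. \<psi> (snd z) (fst z)) \<in> borel_measurable (M \<Otimes>\<^sub>M ?R)"
    using measurable_compose[OF id2 m0] by simp
  have \<xi>: "\<xi> i \<in> borel_measurable M" if "i < k" for i
    using S that t unfolding simple_process_data_def
    by (intro measurable_F_imp_M[of "\<tau> i"]) force+
  have fstM: "(\<lambda>z. \<xi> i (fst z)) \<in> borel_measurable (M \<Otimes>\<^sub>M ?R)" if "i < k" for i
    by (rule measurable_compose[OF measurable_fst \<xi>[OF that]])
  have sndM: "(\<lambda>z. indicat_real {\<tau> i<..\<tau> (Suc i)} (snd z)) \<in> borel_measurable (M \<Otimes>\<^sub>M ?R)" for i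
    by (rule measurable_compose[OF measurable_snd]) (auto intro: measurable_restrict_space1)
  have s: "(\<lambda>z. simple_process k \<tau> \<xi> (snd z) (fst z)) \<in> borel_measurable (M \<Otimes>\<^sub>M ?R)"
    unfolding simple_process_def
    by (intro borel_measurable_sum borel_measurable_times fstM sndM) auto
  have "(\<lambda>z. ennreal ((simple_process k \<tau> \<xi> (snd z) (fst z) - \<psi> (snd z) (fst z))\<^sup>2))
      \<in> borel_measurable (M \<Otimes>\<^sub>M ?R)"
    by (intro measurable_compose[OF _ measurable_ennreal] borel_measurable_power borel_measurable_diff s m)
  then have "(\<lambda>\<omega>. \<integral>\<^sup>+u. ennreal ((simple_process k \<tau> \<xi> u \<omega> - \<psi> u \<omega>)\<^sup>2) \<partial>?R) \<in> borel_measurable M"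
    by (intro R.borel_measurable_nn_integral) (simp add: case_prod_beta')
  then show ?thesis
    by (subst (asm) nn_integral_restrict_space) auto
qed

lemma simple_process_section_measurable: "(\<lambda>u. simple_process k \<tau> \<xi> u \<omega>) \<in> borel_measurable borel"
  unfolding simple_process_def by measurable

lemma simple_process_data_extend:
  "simple_process_data M F s k \<tau> \<xi> \<Longrightarrow> s \<le> t \<Longrightarrow> simple_process_data M F t k \<tau> \<xi>"
  unfolding simple_process_data_def by force

lemma simple_process_outside:
  assumes "simple_process_data M F s k \<tau> \<xi>" "u \<notin> {0..s}"
  shows "simple_process k \<tau> \<xi> u \<omega> = 0"
  using assms unfolding simple_process_def simple_process_data_def
  by (intro sum.neutral) (force simp: indicator_def)

text \<open>
  The difference of the simple processes is the sum of the two approximation errors and the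
  difference of the integrands; \<open>(a + b + c)\<^sup>2 \<le> 3 * (a\<^sup>2 + b\<^sup>2 + c\<^sup>2)\<close> gives the constant \<open>9 = 3 * 3\<close>.
\<close>

lemma square_integral_triangle:
  assumes S: "simple_process_data M F t k \<tau> \<xi>" and S': "simple_process_data M F s k' \<tau>' \<xi>'"
    and st: "0 \<le> s" "s \<le> t" "t \<le> T" and \<psi>: "progressive F t \<psi>" and \<psi>': "progressive F s \<psi>'"
    and \<omega>: "\<omega> \<in> space M"
    and eq: "\<forall>u\<in>{0..t}. \<phi> u \<omega> = \<psi> u \<omega>" and eq': "\<forall>u\<in>{0..s}. \<phi>' u \<omega> = \<psi>' u \<omega>"
    and d: "(\<integral>\<^sup>+u\<in>{0..t}. ennreal ((simple_process k \<tau> \<xi> u \<omega> - \<psi> u \<omega>)\<^sup>2) \<partial>lborel) \<le> ennreal v"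
    and d': "(\<integral>\<^sup>+u\<in>{0..s}. ennreal ((simple_process k' \<tau>' \<xi>' u \<omega> - \<psi>' u \<omega>)\<^sup>2) \<partial>lborel) \<le> ennreal v"
    and e: "(\<integral>\<^sup>+u\<in>{0..t}. ennreal ((\<phi> u \<omega> - indicator {0..s} u * \<phi>' u \<omega>)\<^sup>2) \<partial>lborel) \<le> ennreal v"
    and v: "v > 0"
  shows "(\<integral>\<^sup>+u\<in>{0..t}. ennreal ((simple_process k \<tau> \<xi> u \<omega> - simple_process k' \<tau>' \<xi>' u \<omega>)\<^sup>2) \<partial>lborel)
    \<le> ennreal (9 * v)"
proof -
  let ?S = "\<lambda>u. simple_process k \<tau> \<xi> u \<omega>" and ?S' = "\<lambda>u. simple_process k' \<tau>' \<xi>' u \<omega>"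
  define P where "P u = indicator {0..t} u * \<psi> u \<omega>" for u
  define P' where "P' u = indicator {0..s} u * \<psi>' u \<omega>" for u
  have [measurable]: "P \<in> borel_measurable borel" "P' \<in> borel_measurable borel"
    "?S \<in> borel_measurable borel" "?S' \<in> borel_measurable borel"
    unfolding P_def[abs_def] P'_def[abs_def]
    using progressive_section_measurable[OF \<psi> _ \<omega>] progressive_section_measurable[OF \<psi>' _ \<omega>] st
      simple_process_section_measurable[of k \<tau> \<xi> \<omega>] simple_process_section_measurable[of k' \<tau>' \<xi>' \<omega>]
    by auto
  let ?a = "\<lambda>u. (?S u - P u)\<^sup>2 * indicator {0..t} u" and ?b = "\<lambda>u. (?S' u - P' u)\<^sup>2 * indicator {0..s} u"
    and ?c = "\<lambda>u. (P u - P' u)\<^sup>2 * indicator {0..t} u"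
  have a: "(\<integral>\<^sup>+u. ennreal (?a u) \<partial>lborel) \<le> ennreal v"
    by (rule order_trans[OF eq_refl d], rule nn_integral_cong) (auto simp: P_def indicator_def)
  have b: "(\<integral>\<^sup>+u. ennreal (?b u) \<partial>lborel) \<le> ennreal v"
    by (rule order_trans[OF eq_refl d'], rule nn_integral_cong) (auto simp: P'_def indicator_def)
  have c: "(\<integral>\<^sup>+u. ennreal (?c u) \<partial>lborel) \<le> ennreal v"
    by (rule order_trans[OF eq_refl e], rule nn_integral_cong)
      (use eq eq' st in \<open>auto simp: P_def P'_def indicator_def\<close>)
  have three: "(x + y + z)\<^sup>2 \<le> 3 * (x\<^sup>2 + y\<^sup>2 + z\<^sup>2)" for x y z :: real
  proof -
    have "0 \<le> (x - y)\<^sup>2 + (y - z)\<^sup>2 + (x - z)\<^sup>2" by simp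
    then show ?thesis by (simp add: power2_eq_square algebra_simps)
  qed
  have "ennreal ((?S u - ?S' u)\<^sup>2) * indicator {0..t} u
      \<le> 3 * (ennreal (?a u) + ennreal (?b u) + ennreal (?c u))" for u
  proof (cases "u \<in> {0..t}")
    case True
    have b0: "(?S' u - P' u)\<^sup>2 = ?b u"
      using simple_process_outside[OF S', of u \<omega>] by (auto simp: indicator_def P'_def)
    have "(?S u - ?S' u)\<^sup>2 = ((?S u - P u) + (P' u - ?S' u) + (P u - P' u))\<^sup>2" by simp
    also have "\<dots> \<le> 3 * ((?S u - P u)\<^sup>2 + (P' u - ?S' u)\<^sup>2 + (P u - P' u)\<^sup>2)" by (rule three)
    also have "\<dots> = 3 * (?a u + ?b u + ?c u)"
      using True b0 by (simp add: power2_commute)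
    finally have "ennreal ((?S u - ?S' u)\<^sup>2) \<le> ennreal (3 * (?a u + ?b u + ?c u))"
      by (rule ennreal_leI)
    also have "\<dots> = 3 * (ennreal (?a u) + ennreal (?b u) + ennreal (?c u))"
      by (subst ennreal_mult) (auto simp del: times_divide_eq_left)
    finally show ?thesis using True by simp
  next
    case False then show ?thesis by simp
  qed
  then have "(\<integral>\<^sup>+u\<in>{0..t}. ennreal ((?S u - ?S' u)\<^sup>2) \<partial>lborel)
      \<le> (\<integral>\<^sup>+u. 3 * (ennreal (?a u) + ennreal (?b u) + ennreal (?c u)) \<partial>lborel)"
    by (intro nn_integral_mono)
  also have "\<dots> = 3 * ((\<integral>\<^sup>+u. ennreal (?a u) \<partial>lborel) + (\<integral>\<^sup>+u. ennreal (?b u) \<partial>lborel) + (\<integral>\<^sup>+u. ennreal (?c u) \<partial>lborel))"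
    by (subst nn_integral_cmult, measurable, subst nn_integral_add, measurable, subst nn_integral_add) measurable
  also have "\<dots> \<le> 3 * (ennreal v + ennreal v + ennreal v)"
    by (intro mult_left_mono add_mono a b c) auto
  also have "\<dots> = ennreal 3 * ennreal (3 * v)"
    using v by (simp add: ennreal_plus[symmetric] del: ennreal_plus)
  also have "\<dots> = ennreal (9 * v)"
    using v by (subst ennreal_mult[symmetric]) auto
  finally show ?thesis by simp
qed

text \<open>
  The Gaussian tail of simple integrals survives the limit in probability. The bound on the square
  integral of the integrands transfers to their simple approximations outside events of vanishing
  probability, at the price of constants: the three copies of \<open>a\<close> account for the two approximation
  errors of the integrals and for the simple integral itself.
\<close>

lemma ito_difference_tail:
  assumes B: "brownian_motion M F T B" and st: "0 \<le> s" "s \<le> t" "t \<le> T"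
    and Y: "has_ito_integral M F B t \<phi> Y" and Y': "has_ito_integral M F B s \<phi>' Y'"
    and bound: "AE \<omega> in M. (\<integral>\<^sup>+u\<in>{0..t}. ennreal ((\<phi> u \<omega> - indicator {0..s} u * \<phi>' u \<omega>)\<^sup>2) \<partial>lborel) \<le> ennreal v"
    and a: "a > 0" and v: "v > 0"
  shows "prob {\<omega>\<in>space M. \<bar>Y \<omega> - Y' \<omega>\<bar> > 3 * a} \<le> 2 * exp (- (a\<^sup>2 / (18 * v)))"
proof -
  obtain \<psi> k \<tau> \<xi> where ver: "ito_integrand_version M F t \<phi> \<psi>"
    and S: "\<And>n. simple_process_data M F t (k n) (\<tau> n) (\<xi> n)"
    and dn: "null_in_prob M (\<lambda>n \<omega>. \<integral>\<^sup>+u\<in>{0..t}. ennreal ((simple_process (k n) (\<tau> n) (\<xi> n) u \<omega> - \<psi> u \<omega>)\<^sup>2) \<partial>lborel)"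
    and In: "null_in_prob M (\<lambda>n \<omega>. ennreal \<bar>simple_integral B (k n) (\<tau> n) (\<xi> n) \<omega> - Y \<omega>\<bar>)"
    using Y unfolding has_ito_integral_def by blast
  obtain \<psi>' k' \<tau>' \<xi>' where ver': "ito_integrand_version M F s \<phi>' \<psi>'"
    and S': "\<And>n. simple_process_data M F s (k' n) (\<tau>' n) (\<xi>' n)"
    and dn': "null_in_prob M (\<lambda>n \<omega>. \<integral>\<^sup>+u\<in>{0..s}. ennreal ((simple_process (k' n) (\<tau>' n) (\<xi>' n) u \<omega> - \<psi>' u \<omega>)\<^sup>2) \<partial>lborel)"
    and In': "null_in_prob M (\<lambda>n \<omega>. ennreal \<bar>simple_integral B (k' n) (\<tau>' n) (\<xi>' n) \<omega> - Y' \<omega>\<bar>)"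
    using Y' unfolding has_ito_integral_def by blast
  have [measurable]: "Y \<in> borel_measurable M" "Y' \<in> borel_measurable M"
    using Y Y' unfolding has_ito_integral_def by auto
  have prog: "progressive F t \<psi>" "progressive F s \<psi>'"
    using ver ver' unfolding ito_integrand_version_def by auto
  let ?d = "\<lambda>n \<omega>. \<integral>\<^sup>+u\<in>{0..t}. ennreal ((simple_process (k n) (\<tau> n) (\<xi> n) u \<omega> - \<psi> u \<omega>)\<^sup>2) \<partial>lborel"
  let ?d' = "\<lambda>n \<omega>. \<integral>\<^sup>+u\<in>{0..s}. ennreal ((simple_process (k' n) (\<tau>' n) (\<xi>' n) u \<omega> - \<psi>' u \<omega>)\<^sup>2) \<partial>lborel"
  let ?I = "\<lambda>n. simple_integral B (k n) (\<tau> n) (\<xi> n)" and ?I' = "\<lambda>n. simple_integral B (k' n) (\<tau>' n) (\<xi>' n)"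
  have [measurable]: "?I n \<in> borel_measurable M" "?I' n \<in> borel_measurable M" for n
    by (rule simple_integral_measurable[OF B S], use st in simp)
      (rule simple_integral_measurable[OF B S'], use st in simp)
  have dm: "?d n \<in> borel_measurable M" "?d' n \<in> borel_measurable M" for n
    by (rule approximation_error_measurable[OF S prog(1)], use st in simp)
      (rule approximation_error_measurable[OF S' prog(2)], use st in simp)
  let ?A1 = "\<lambda>n. {\<omega>\<in>space M. ennreal \<bar>?I n \<omega> - Y \<omega>\<bar> > ennreal a}"
    and ?A2 = "\<lambda>n. {\<omega>\<in>space M. ennreal \<bar>?I' n \<omega> - Y' \<omega>\<bar> > ennreal a}"
    and ?A3 = "\<lambda>n. {\<omega>\<in>space M. ?d n \<omega> > ennreal v}" and ?A4 = "\<lambda>n. {\<omega>\<in>space M. ?d' n \<omega> > ennreal v}"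
  let ?E = "{\<omega>\<in>space M. \<bar>Y \<omega> - Y' \<omega>\<bar> > 3 * a}"
  have ev12: "?A1 n \<in> events" "?A2 n \<in> events" for n
    by measurable
  have ev34: "?A3 n \<in> events" "?A4 n \<in> events" for n
    by (rule borel_measurable_less[OF measurable_const dm(1)], simp)
      (rule borel_measurable_less[OF measurable_const dm(2)], simp)
  note ev = ev12 ev34
  have "prob ?E \<le> prob (?A1 n) + prob (?A2 n) + prob (?A3 n) + prob (?A4 n) + 2 * exp (- (a\<^sup>2 / (18 * v)))" for n
  proof -
    have "0 \<le> t" using st by simp
    from simple_process_diff[OF S[of n] simple_process_data_extend[OF S'[of n] st(2)] this st(3), of B]
    obtain N p \<eta> where D: "simple_process_data M F t N p \<eta>"
      and DI: "\<And>\<omega>. simple_integral B N p \<eta> \<omega> = ?I n \<omega> - ?I' n \<omega>"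
      and DS: "\<And>u \<omega>. simple_process N p \<eta> u \<omega>
        = simple_process (k n) (\<tau> n) (\<xi> n) u \<omega> - simple_process (k' n) (\<tau>' n) (\<xi>' n) u \<omega>"
      by blast
    let ?A5 = "{\<omega>\<in>space M. \<bar>simple_integral B N p \<eta> \<omega>\<bar> > a \<and>
      (\<integral>\<^sup>+u\<in>{0..t}. ennreal ((simple_process N p \<eta> u \<omega>)\<^sup>2) \<partial>lborel) \<le> ennreal (9 * v)}"
    have [measurable]: "simple_integral B N p \<eta> \<in> borel_measurable M"
      by (rule simple_integral_measurable[OF B D st(3)])
    have [measurable]: "(\<lambda>\<omega>. \<integral>\<^sup>+u\<in>{0..t}. ennreal ((simple_process N p \<eta> u \<omega>)\<^sup>2) \<partial>lborel) \<in> borel_measurable M"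
      using approximation_error_measurable[OF D, of "\<lambda>_ _. 0"] st
      by (simp add: progressive_def)
    have ev5: "?A5 \<in> events" by measurable
    have "AE \<omega> in M. \<omega> \<in> ?E \<longrightarrow> \<omega> \<in> ?A1 n \<union> ?A2 n \<union> ?A3 n \<union> ?A4 n \<union> ?A5"
    proof -
      have "AE \<omega> in M. \<forall>u\<in>{0..t}. \<phi> u \<omega> = \<psi> u \<omega>" "AE \<omega> in M. \<forall>u\<in>{0..s}. \<phi>' u \<omega> = \<psi>' u \<omega>"
        using ver ver' unfolding ito_integrand_version_def by auto
      then show ?thesis
        using bound AE_space
      proof eventually_elim
        case (elim \<omega>)
        show ?case
        proof (intro impI, rule ccontr)
          assume E: "\<omega> \<in> ?E" and "\<omega> \<notin> ?A1 n \<union> ?A2 n \<union> ?A3 n \<union> ?A4 n \<union> ?A5"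
          then have n: "\<bar>?I n \<omega> - Y \<omega>\<bar> \<le> a" "\<bar>?I' n \<omega> - Y' \<omega>\<bar> \<le> a" "?d n \<omega> \<le> ennreal v" "?d' n \<omega> \<le> ennreal v"
            and n5: "\<omega> \<notin> ?A5"
            using elim(4) a by (auto simp: not_less ennreal_le_iff)
          have "\<bar>simple_integral B N p \<eta> \<omega>\<bar> > a"
            using E n(1,2) unfolding DI by auto
          moreover have "(\<integral>\<^sup>+u\<in>{0..t}. ennreal ((simple_process N p \<eta> u \<omega>)\<^sup>2) \<partial>lborel) \<le> ennreal (9 * v)"
            unfolding DS
            by (rule square_integral_triangle[where \<phi> = \<phi> and \<phi>' = \<phi>' and \<psi> = \<psi> and \<psi>' = \<psi>'])
              (fact S S' st prog elim n v)+
          ultimately show False using n5 elim(4) by simp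
        qed
      qed
    qed
    then have "prob ?E \<le> prob (?A1 n \<union> ?A2 n \<union> ?A3 n \<union> ?A4 n \<union> ?A5)"
      using ev ev5 by (intro finite_measure_mono_AE) auto
    also have "\<dots> \<le> prob (?A1 n) + prob (?A2 n) + prob (?A3 n) + prob (?A4 n) + prob ?A5"
      using ev ev5 by (intro order_trans[OF measure_Un_le] add_mono sets.Un order_refl)
    also have "prob ?A5 \<le> 2 * exp (- (a\<^sup>2 / (2 * (9 * v))))"
      using v by (intro simple_integral_tail[OF B D st(3) a]) simp
    finally show ?thesis by simp
  qed
  moreover have "(\<lambda>n. prob (?A1 n) + prob (?A2 n) + prob (?A3 n) + prob (?A4 n) + 2 * exp (- (a\<^sup>2 / (18 * v))))
      \<longlonglongrightarrow> 0 + 0 + 0 + 0 + 2 * exp (- (a\<^sup>2 / (18 * v)))"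
    using In In' dn dn' a v unfolding null_in_prob_def by (intro tendsto_add tendsto_const) auto
  ultimately show ?thesis
    by (intro LIMSEQ_le_const[of _ "2 * exp (- (a\<^sup>2 / (18 * v)))"]) auto
qed

end

section \<open>Increments of the kernel, and chaining\<close>

lemma powr_diff_le_powr_of_diff:
  fixes v w \<theta> :: real
  assumes "0 \<le> v" "v \<le> w" "0 < \<theta>" "\<theta> \<le> 1"
  shows "w powr \<theta> - v powr \<theta> \<le> (w - v) powr \<theta>"
proof (cases "w = 0")
  case True
  then show ?thesis using assms by simp
next
  case False
  then have w: "w > 0" using assms by simp
  have frac: "x * w powr (\<theta> - 1) \<le> x powr \<theta>" if "0 \<le> x" "x \<le> w" for x
  proof (cases "x = 0")
    case False
    then have "x * w powr (\<theta> - 1) \<le> x * x powr (\<theta> - 1)"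
      using that assms by (intro mult_left_mono powr_mono2') auto
    also have "\<dots> = x powr \<theta>" using False that by (simp add: powr_mult_base)
    finally show ?thesis .
  qed simp
  have "w powr \<theta> = v * w powr (\<theta> - 1) + (w - v) * w powr (\<theta> - 1)"
    using w by (simp add: algebra_simps powr_mult_base)
  then show ?thesis using frac[of v] frac[of "w - v"] assms by simp
qed

text \<open>
  One half of the available regularity is spent on the increment \<open>w - v\<close>, the other half on the
  singularity at \<open>v = 0\<close>, whose square \<open>v powr (h - 1)\<close> is still integrable. The bound is uniform in
  the exponent \<open>b\<close>, which in the kernel varies with time along the path. The proof compares
  derivatives.
\<close>

lemma powr_increment_bound:
  fixes b h v w R :: real
  assumes h: "0 < h" "h < 1" and b: "h - 1/2 \<le> b" "b \<le> 1/2"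
    and vw: "0 < v" "v \<le> w" "w \<le> R" and R: "1 \<le> R"
  shows "\<bar>w powr b - v powr b\<bar> \<le> (2 * R / h) * v powr ((h - 1) / 2) * (w - v) powr (h / 2)"
proof -
  define K where "K = R * v powr ((h - 1) / 2)"
  have K: "K \<ge> 0" using R by (simp add: K_def)
  have der: "\<bar>b * x powr (b - 1)\<bar> \<le> K * x powr (h / 2 - 1)" if x: "v \<le> x" "x \<le> w" for x
  proof -
    have x0: "x > 0" using x vw by simp
    have "x powr (b - h + 1/2) \<le> R powr (b - h + 1/2)"
      using x vw b by (intro powr_mono2) auto
    also have "\<dots> \<le> R powr 1" using R b h by (intro powr_mono) auto
    finally have 1: "x powr (b - h + 1/2) \<le> R" using R by simp
    have 2: "x powr ((h - 1) / 2) \<le> v powr ((h - 1) / 2)"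
      using x vw h by (intro powr_mono2') auto
    have "\<bar>b * x powr (b - 1)\<bar> \<le> 1 * x powr (b - 1)"
      unfolding abs_mult using b h by (intro mult_mono) auto
    also have "\<dots> = x powr (b - h + 1/2) * x powr ((h - 1) / 2) * x powr (h / 2 - 1)"
    proof -
      have "b - 1 = (b - h + 1/2) + (h - 1) / 2 + (h / 2 - 1)" by (simp add: field_simps)
      then show ?thesis by (metis mult_1 powr_add)
    qed
    also have "\<dots> \<le> R * v powr ((h - 1) / 2) * x powr (h / 2 - 1)"
      using 1 2 R by (intro mult_right_mono mult_mono) auto
    finally show ?thesis by (simp add: K_def)
  qed
  define G where "G x = K * (2 / h) * x powr (h / 2)" for x
  \<comment> \<open>The signs \<open>\<epsilon> = 1\<close> and \<open>\<epsilon> = -1\<close> give the two halves of the absolute value.\<close>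
  have "(\<lambda>x. G x - \<epsilon> * x powr b) v \<le> (\<lambda>x. G x - \<epsilon> * x powr b) w" if "\<bar>\<epsilon>\<bar> = 1" for \<epsilon>
  proof (rule DERIV_nonneg_imp_nondecreasing[OF vw(2)], intro exI conjI)
    fix x assume x: "v \<le> x" "x \<le> w"
    show "((\<lambda>x. G x - \<epsilon> * x powr b) has_real_derivative
        K * x powr (h / 2 - 1) - \<epsilon> * (b * x powr (b - 1))) (at x)"
      unfolding G_def using x vw h
      by (auto intro!: derivative_eq_intros simp: field_simps)
    have "\<bar>\<epsilon> * (b * x powr (b - 1))\<bar> \<le> K * x powr (h / 2 - 1)"
      using der[OF x] that by (simp add: abs_mult)
    then show "0 \<le> K * x powr (h / 2 - 1) - \<epsilon> * (b * x powr (b - 1))" by linarith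
  qed
  from this[of 1] this[of "-1"] have "\<bar>w powr b - v powr b\<bar> \<le> G w - G v" by simp
  also have "\<dots> = K * (2 / h) * (w powr (h / 2) - v powr (h / 2))"
    by (simp add: G_def right_diff_distrib)
  also have "\<dots> \<le> K * (2 / h) * (w - v) powr (h / 2)"
    using K h vw by (intro mult_left_mono powr_diff_le_powr_of_diff) auto
  finally show ?thesis by (simp add: K_def mult_ac)
qed

lemma nn_integral_powr_to_endpoint:
  fixes a b e :: real
  assumes "e > -1" "a \<le> b"
  shows "(\<integral>\<^sup>+u\<in>{a..b}. ennreal ((b - u) powr e) \<partial>lborel) = ennreal ((b - a) powr (e + 1) / (e + 1))"
proof -
  have "((\<lambda>x. if x \<in> {0..b - a} then x powr e else 0) has_integral ((b - a) powr (e + 1) / (e + 1))) UNIV"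
    unfolding has_integral_restrict_UNIV using has_integral_powr_from_0[of e "b - a"] assms by simp
  also have "(\<lambda>x. if x \<in> {0..b - a} then x powr e else 0) = (\<lambda>x. x powr e * indicator {0..b - a} x)"
    by (auto simp: indicator_def)
  finally have *: "(\<integral>\<^sup>+x. ennreal (x powr e * indicator {0..b - a} x) \<partial>lborel) = ennreal ((b - a) powr (e + 1) / (e + 1))"
    by (intro nn_integral_has_integral_lborel) auto
  have "(\<integral>\<^sup>+x. ennreal (x powr e * indicator {0..b - a} x) \<partial>lborel)
      = (\<integral>\<^sup>+u. ennreal ((b + (-1) * u) powr e * indicator {0..b - a} (b + (-1) * u)) \<partial>lborel)"
    by (subst nn_integral_real_affine[where c = "-1" and t = b]) auto
  also have "\<dots> = (\<integral>\<^sup>+u\<in>{a..b}. ennreal ((b - u) powr e) \<partial>lborel)"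
    by (intro nn_integral_cong) (auto simp: indicator_def)
  finally show ?thesis using * by simp
qed

text \<open>
  The exponent of the kernel is determined by the integration variable \<open>u\<close>, so a change of the outer time
  only moves the base of the power. On \<open>{0..s}\<close> this is controlled by the increment bound for powers,
  and on \<open>{s..t}\<close> by the singularity of the kernel itself. Only the bounds on \<open>H\<close> enter, which makes
  the estimate deterministic.
\<close>

lemma rfbm_kernel_increment_L2:
  fixes H :: "real \<Rightarrow> real \<Rightarrow> real" and x :: "real \<Rightarrow> real"
  assumes h: "0 < h" "h < 1" and H: "\<And>u. 0 \<le> u \<Longrightarrow> u \<le> t \<Longrightarrow> h \<le> H u (x u) \<and> H u (x u) < 1"
    and st: "0 \<le> s" "s < t" and R: "1 \<le> R" "t \<le> R"
  shows "(\<integral>\<^sup>+u\<in>{0..t}. ennreal ((rfbm_kernel H t u (x u) - indicator {0..s} u * rfbm_kernel H s u (x u))\<^sup>2) \<partial>lborel)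
    \<le> ennreal (18 * R ^ 3 / h ^ 3 * (t - s) powr h)"
proof -
  let ?g = "\<lambda>u. 16 * R\<^sup>2 / h\<^sup>2 * (t - s) powr h * ((s - u) powr (h - 1) * indicator {0..s} u)
      + 4 * R\<^sup>2 * ((t - u) powr (2 * h - 1) * indicator {s..t} u)"
  have sqrt2: "sqrt (2 * a) \<le> 2" if "a < 1" for a :: real
    using that by (intro real_le_lsqrt) auto
  have sq_le: "c\<^sup>2 \<le> d\<^sup>2" if "\<bar>c\<bar> \<le> d" for c d :: real
    using that by (metis abs_ge_zero power2_abs power_mono)
  have pw: "(y powr (c / 2))\<^sup>2 = y powr c" for y c :: real
    by (simp add: power2_eq_square powr_add[symmetric])
  have half: "h - 1/2 = (2 * h - 1) / 2" by (simp add: field_simps)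
  have pt: "(rfbm_kernel H t u (x u) - indicator {0..s} u * rfbm_kernel H s u (x u))\<^sup>2 * indicator {0..t} u \<le> ?g u"
    if "u \<noteq> s" "u \<noteq> t" for u
  proof (cases "u \<in> {0..t}")
    case u: True
    let ?a = "H u (x u)"
    have a: "h \<le> ?a" "?a < 1" using H[of u] u by auto
    note s2 = sqrt2[OF a(2)]
    show ?thesis
    proof (cases "u < s")
      case True
      let ?B = "(2 * R / h) * (s - u) powr ((h - 1) / 2) * (t - s) powr (h / 2)"
      have "\<bar>(t - u) powr (?a - 1/2) - (s - u) powr (?a - 1/2)\<bar>
          \<le> (2 * R / h) * (s - u) powr ((h - 1) / 2) * ((t - u) - (s - u)) powr (h / 2)"
        using a True st u R by (intro powr_increment_bound h) auto
      then have "\<bar>rfbm_kernel H t u (x u) - rfbm_kernel H s u (x u)\<bar> \<le> 2 * ?B"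
        unfolding rfbm_kernel_def right_diff_distrib[symmetric] abs_mult
        using s2 a h by (intro mult_mono) auto
      then have "(rfbm_kernel H t u (x u) - rfbm_kernel H s u (x u))\<^sup>2 \<le> (2 * ?B)\<^sup>2" by (rule sq_le)
      also have "\<dots> = 16 * R\<^sup>2 / h\<^sup>2 * (t - s) powr h * (s - u) powr (h - 1)"
        by (simp add: power_mult_distrib power_divide pw mult_ac)
      finally show ?thesis using True u by (simp add: indicator_def)
    next
      case False
      with that have su: "s < u" by simp
      have "\<bar>rfbm_kernel H t u (x u)\<bar> \<le> 2 * (R * (t - u) powr (h - 1/2))"
      proof -
        have "(t - u) powr (?a - h) \<le> R powr (?a - h)"
          using u R a st su by (intro powr_mono2) auto
        also have "\<dots> \<le> R powr 1" using R a h by (intro powr_mono) auto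
        finally have "(t - u) powr (?a - h) * (t - u) powr (h - 1/2) \<le> R * (t - u) powr (h - 1/2)"
          using R by (intro mult_right_mono) auto
        then have "(t - u) powr (?a - 1/2) \<le> R * (t - u) powr (h - 1/2)"
          by (simp add: powr_add[symmetric])
        then show ?thesis
          unfolding rfbm_kernel_def abs_mult using s2 a h by (intro mult_mono) auto
      qed
      then have "(rfbm_kernel H t u (x u))\<^sup>2 \<le> (2 * (R * (t - u) powr (h - 1/2)))\<^sup>2" by (rule sq_le)
      also have "\<dots> = 4 * R\<^sup>2 * (t - u) powr (2 * h - 1)"
        by (simp only: power_mult_distrib half pw) simp
      finally show ?thesis using su u by (simp add: indicator_def)
    qed
  next
    case False
    then show ?thesis using st by (auto simp: indicator_def)
  qed
  have gn: "0 \<le> 16 * R\<^sup>2 / h\<^sup>2 * (t - s) powr h" by simp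
  have ge: "ennreal (?g u) = ennreal (16 * R\<^sup>2 / h\<^sup>2 * (t - s) powr h) * (ennreal ((s - u) powr (h - 1)) * indicator {0..s} u)
      + ennreal (4 * R\<^sup>2) * (ennreal ((t - u) powr (2 * h - 1)) * indicator {s..t} u)" for u
    by (auto simp: indicator_def ennreal_mult[symmetric] ennreal_plus[symmetric] simp del: ennreal_plus)
  have "(\<integral>\<^sup>+u\<in>{0..t}. ennreal ((rfbm_kernel H t u (x u) - indicator {0..s} u * rfbm_kernel H s u (x u))\<^sup>2) \<partial>lborel)
      \<le> (\<integral>\<^sup>+u. ennreal (?g u) \<partial>lborel)"
  proof (rule nn_integral_mono_AE)
    have "AE u in lborel. u \<noteq> s" "AE u in lborel. u \<noteq> t" by (rule AE_lborel_singleton)+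
    then show "AE u in lborel. ennreal ((rfbm_kernel H t u (x u) - indicator {0..s} u * rfbm_kernel H s u (x u))\<^sup>2) * indicator {0..t} u
        \<le> ennreal (?g u)"
    proof eventually_elim
      case (elim u)
      show ?case
        using ennreal_leI[OF pt[OF elim]] by (auto simp: indicator_def split: if_splits)
    qed
  qed
  also have "\<dots> = ennreal (16 * R\<^sup>2 / h\<^sup>2 * (t - s) powr h) * ennreal (s powr h / h)
      + ennreal (4 * R\<^sup>2) * ennreal ((t - s) powr (2 * h) / (2 * h))"
    unfolding ge
    using nn_integral_powr_to_endpoint[of "h - 1" 0 s] nn_integral_powr_to_endpoint[of "2 * h - 1" s t] h st
    by (subst nn_integral_add, simp, simp, subst nn_integral_cmult, simp, subst nn_integral_cmult, simp) simp
  also have "\<dots> = ennreal (16 * R\<^sup>2 / h\<^sup>2 * (t - s) powr h * (s powr h / h) + 4 * R\<^sup>2 * ((t - s) powr (2 * h) / (2 * h)))"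
    using h by (simp add: ennreal_mult[symmetric] ennreal_plus[symmetric] del: ennreal_plus)
  also have "\<dots> \<le> ennreal (18 * R ^ 3 / h ^ 3 * (t - s) powr h)"
  proof (rule ennreal_leI)
    have pR: "y powr h \<le> R" if "0 \<le> y" "y \<le> t" for y
    proof -
      have "y powr h \<le> R powr h" using that R h by (intro powr_mono2) auto
      also have "\<dots> \<le> R powr 1" using R h by (intro powr_mono) auto
      finally show ?thesis using R by simp
    qed
    let ?d = "(t - s) powr h"
    have "16 * R\<^sup>2 / h\<^sup>2 * ?d * (s powr h / h) \<le> 16 * R\<^sup>2 / h\<^sup>2 * ?d * (R / h)"
      using pR[of s] st h by (intro mult_left_mono divide_right_mono) auto
    also have "\<dots> = 16 * R ^ 3 / h ^ 3 * ?d" by (simp add: power2_eq_square power3_eq_cube)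
    finally have 1: "16 * R\<^sup>2 / h\<^sup>2 * ?d * (s powr h / h) \<le> 16 * R ^ 3 / h ^ 3 * ?d" .
    have "(t - s) powr (2 * h) = ?d * ?d" by (simp add: powr_add[symmetric])
    then have "4 * R\<^sup>2 * ((t - s) powr (2 * h) / (2 * h)) = 4 * R\<^sup>2 * (?d * ?d / (2 * h))" by simp
    also have "\<dots> \<le> 4 * R\<^sup>2 * (R * ?d / (2 * h))"
      using pR[of "t - s"] st h by (intro mult_left_mono divide_right_mono mult_right_mono) auto
    also have "\<dots> = 2 * R ^ 3 * ?d / h" by (simp add: power2_eq_square power3_eq_cube)
    also have "\<dots> \<le> 2 * R ^ 3 * ?d / h ^ 3"
      using R h power_decreasing[of 1 3 h] by (intro divide_left_mono) auto
    finally have 2: "4 * R\<^sup>2 * ((t - s) powr (2 * h) / (2 * h)) \<le> 2 * R ^ 3 / h ^ 3 * ?d" by simp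
    show "16 * R\<^sup>2 / h\<^sup>2 * ?d * (s powr h / h) + 4 * R\<^sup>2 * ((t - s) powr (2 * h) / (2 * h)) \<le> 18 * R ^ 3 / h ^ 3 * ?d"
    proof -
      have "18 * R ^ 3 / h ^ 3 * ?d = 16 * R ^ 3 / h ^ 3 * ?d + 2 * R ^ 3 / h ^ 3 * ?d"
        by (simp add: distrib_right[symmetric] add_divide_distrib[symmetric])
      then show ?thesis using add_mono[OF 1 2] by (simp only:)
    qed
  qed
  finally show ?thesis .
qed

lemma summable_doubling_times_stretched_exponential:
  fixes c q :: real
  assumes "c > 0" "q > 1"
  shows "summable (\<lambda>n. 2 ^ n * exp (- (c * q ^ n)))"
proof -
  have "(\<lambda>n. 4 ^ n * exp (- (c * q ^ n))) \<longlonglongrightarrow> 0"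
    using assms by real_asymp
  then have "eventually (\<lambda>n. 4 ^ n * exp (- (c * q ^ n)) < 1) sequentially"
    by (rule order_tendstoD) simp
  then have "eventually (\<lambda>n. norm (2 ^ n * exp (- (c * q ^ n))) \<le> (1/2) ^ n) sequentially"
  proof eventually_elim
    case (elim n)
    have "(2::real) ^ n * 2 ^ n = 4 ^ n" by (simp add: power_mult_distrib[symmetric])
    with elim have "2 ^ n * (2 ^ n * exp (- (c * q ^ n))) \<le> 1" by (simp add: mult.assoc[symmetric])
    then show ?case by (simp add: power_divide field_simps)
  qed
  then show ?thesis
    by (rule summable_comparison_test_ev) (simp add: summable_geometric)
qed

text \<open>
  Chaining as in Kolmogorov's continuity theorem, but towards the single point \<open>t\<close>. The grid of level
  \<open>m\<close>, where \<open>t - s\<close> is comparable to \<open>t / 2 ^ m\<close>, contains a point next to both \<open>s\<close> and \<open>t\<close>; from there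
  the dyadic approximations of \<open>s\<close> from below move by at most one cell per level, and the increments
  form a geometric series.
\<close>

lemma hoelder_at_right_endpoint:
  fixes x :: "real \<Rightarrow> real"
  assumes t: "t > 0" and cont: "continuous_on {0..t} x" and \<alpha>: "\<alpha> > 0"
    and grid: "\<And>n i. n \<ge> n0 \<Longrightarrow> i < 2 ^ n \<Longrightarrow>
      \<bar>x (t * real (Suc i) / 2 ^ n) - x (t * real i / 2 ^ n)\<bar> \<le> (t / 2 ^ n) powr \<alpha>"
  shows "\<exists>C. \<forall>s. t - t / 2 ^ n0 \<le> s \<longrightarrow> s < t \<longrightarrow> \<bar>x s - x t\<bar> \<le> C * (t - s) powr \<alpha>"
proof (intro exI allI impI)
  fix s assume s: "t - t / 2 ^ n0 \<le> s" "s < t"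
  define \<rho> where "\<rho> = (1/2 :: real) powr \<alpha>"
  have \<rho>: "0 < \<rho>" "\<rho> < 1"
    using \<alpha> powr_less_mono2[of \<alpha> "1/2" 1] by (auto simp: \<rho>_def)
  have s0: "0 \<le> s"
  proof -
    have "t / 2 ^ n0 \<le> t" using t by (simp add: field_simps)
    then show ?thesis using s by simp
  qed
  \<comment> \<open>The dyadic scale of the distance to the endpoint.\<close>
  obtain m where m: "m \<ge> n0" "t - s \<le> t / 2 ^ m" "t / 2 ^ Suc m < t - s"
  proof -
    have ev: "\<exists>n. t / 2 ^ Suc n < t - s"
    proof -
      have "(\<lambda>n. t * (1/2) ^ n) \<longlonglongrightarrow> t * 0" by (intro tendsto_mult tendsto_const LIMSEQ_realpow_zero) auto
      then have "eventually (\<lambda>n. t * (1/2) ^ n < t - s) sequentially"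
        using s by (intro order_tendstoD) auto
      then obtain N where "\<And>n. n \<ge> N \<Longrightarrow> t * (1/2) ^ n < t - s"
        unfolding eventually_sequentially by blast
      from this[of "Suc N"] have "t * (1/2) ^ Suc N < t - s" by simp
      then show ?thesis by (auto simp: power_divide intro!: exI[of _ N])
    qed
    define m where "m = (LEAST n. t / 2 ^ Suc n < t - s)"
    have m1: "t / 2 ^ Suc m < t - s" unfolding m_def by (rule LeastI_ex[OF ev])
    have m2: "t - s \<le> t / 2 ^ Suc n" if "n < m" for n
      using not_less_Least[of n "\<lambda>n. t / 2 ^ Suc n < t - s"] that unfolding m_def by auto
    have "n0 \<le> m"
    proof (rule ccontr)
      assume "\<not> n0 \<le> m"
      then have "Suc m \<le> n0" by simp
      then have "t / 2 ^ n0 \<le> t / 2 ^ Suc m"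
        using t by (intro divide_left_mono power_increasing) auto
      then show False using m1 s by linarith
    qed
    moreover have "t - s \<le> t / 2 ^ m"
    proof (cases m)
      case 0
      then show ?thesis using s0 by simp
    next
      case (Suc n)
      then show ?thesis using m2[of n] by simp
    qed
    ultimately show ?thesis using that m1 by blast
  qed
  \<comment> \<open>The last grid point of level \<open>n\<close> that does not exceed \<open>s\<close> is \<open>p n\<close>, with index \<open>k n\<close>.\<close>
  define k where "k n = nat \<lfloor>2 ^ n * s / t\<rfloor>" for n
  define p where "p n = t * real (k n) / 2 ^ n" for n
  have rk: "real (k n) \<le> 2 ^ n * s / t" "2 ^ n * s / t < real (k n) + 1" for n
  proof -
    have "0 \<le> 2 ^ n * s / t" using s0 t by simp
    then have "real (k n) = of_int \<lfloor>2 ^ n * s / t\<rfloor>" by (simp add: k_def)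
    then show "real (k n) \<le> 2 ^ n * s / t" "2 ^ n * s / t < real (k n) + 1" by linarith+
  qed
  have st: "2 ^ n * s / t < 2 ^ n" for n using s t by (simp add: field_simps)
  have k_lt: "k n < 2 ^ n" for n
  proof -
    have "real (k n) < 2 ^ n" by (rule le_less_trans[OF rk(1) st])
    then show ?thesis by simp
  qed
  have p_s: "p n \<le> s" "s < p n + t / 2 ^ n" for n
  proof -
    have "t * real (k n) \<le> t * (2 ^ n * s / t)" using rk(1) t by (intro mult_left_mono) auto
    then show "p n \<le> s" using t by (simp add: p_def field_simps)
    have "t * (2 ^ n * s / t) < t * (real (k n) + 1)" using rk(2) t by (intro mult_strict_left_mono) auto
    then show "s < p n + t / 2 ^ n" using t by (simp add: p_def field_simps)
  qed
  have p0: "0 \<le> p n" for n using t by (simp add: p_def)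
  have base: "\<bar>x (p m) - x t\<bar> \<le> (t / 2 ^ m) powr \<alpha>"
  proof -
    have "2 ^ m * s / t \<ge> 2 ^ m - 1"
      using m(2) t by (simp add: field_simps)
    then have "real (k m) + 1 > 2 ^ m - 1" using rk(2)[of m] by linarith
    then have "real (Suc (Suc (k m))) > real (2 ^ m)" by simp
    then have "Suc (Suc (k m)) > 2 ^ m" by (simp only: of_nat_less_iff)
    then have "Suc (k m) = 2 ^ m" using k_lt[of m] by linarith
    then have "real (Suc (k m)) = 2 ^ m" by (metis of_nat_numeral of_nat_power)
    then have "t * real (Suc (k m)) / 2 ^ m = t" by simp
    then show ?thesis
      using grid[OF m(1) k_lt[of m]] by (simp only: p_def abs_minus_commute)
  qed
  have step: "\<bar>x (p (Suc n)) - x (p n)\<bar> \<le> (t / 2 ^ Suc n) powr \<alpha>" if n: "m \<le> n" for n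
  proof -
    have pn: "p n = t * real (2 * k n) / 2 ^ Suc n" by (simp add: p_def)
    have "real (2 * k n) \<le> 2 ^ Suc n * s / t" "2 ^ Suc n * s / t < real (2 * k n) + 2"
      using rk[of n] by auto
    then have "real (2 * k n) < real (Suc (k (Suc n)))" "real (k (Suc n)) < real (2 * k n + 2)"
      using rk[of "Suc n"] by auto
    then have "2 * k n \<le> k (Suc n)" "k (Suc n) \<le> Suc (2 * k n)"
      by (simp_all only: of_nat_less_iff)
    then consider "k (Suc n) = 2 * k n" | "k (Suc n) = Suc (2 * k n)" by linarith
    then show ?thesis
    proof cases
      case 1
      then have "p (Suc n) = p n" by (simp add: pn p_def[of "Suc n"])
      then show ?thesis by simp
    next
      case 2
      then have "2 * k n < 2 ^ Suc n" using k_lt[of n] by simp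
      moreover have "Suc n \<ge> n0" using n m(1) by simp
      ultimately show ?thesis
        using grid[of "Suc n" "2 * k n"] by (simp only: pn p_def[of "Suc n"] 2)
    qed
  qed
  have scale: "(t / 2 ^ (m + i)) powr \<alpha> = (t / 2 ^ m) powr \<alpha> * \<rho> ^ i" for i
  proof -
    have "t / 2 ^ (m + i) = (t / 2 ^ m) * (1/2) ^ i" by (simp add: power_add power_divide)
    moreover have "((1/2 :: real) ^ i) powr \<alpha> = \<rho> ^ i"
      by (simp add: \<rho>_def powr_powr powr_realpow[symmetric] mult.commute)
    ultimately show ?thesis using t by (simp only: powr_mult)
  qed
  have partial: "\<bar>x (p (m + j)) - x t\<bar> \<le> (t / 2 ^ m) powr \<alpha> * (\<Sum>i\<le>j. \<rho> ^ i)" for j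
  proof (induction j)
    case 0
    then show ?case using base by simp
  next
    case (Suc j)
    have "\<bar>x (p (m + Suc j)) - x (p (m + j))\<bar> \<le> (t / 2 ^ m) powr \<alpha> * \<rho> ^ Suc j"
      using step[of "m + j"] scale[of "Suc j"] by simp
    then show ?case using Suc.IH by (simp add: algebra_simps)
  qed
  have geo: "(\<Sum>i\<le>j. \<rho> ^ i) \<le> 1 / (1 - \<rho>)" for j
    using \<rho> sum_le_suminf[of "\<lambda>i. \<rho> ^ i" "{..j}"] suminf_geometric[of \<rho>] by (simp add: summable_geometric)
  have "p \<longlonglongrightarrow> s"
  proof (rule tendsto_sandwich[OF _ _ _ tendsto_const])
    have "(\<lambda>n. s - t * (1/2) ^ n) \<longlonglongrightarrow> s - t * 0"
      by (intro tendsto_intros LIMSEQ_realpow_zero) auto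
    then show "(\<lambda>n. s - t * (1/2) ^ n) \<longlonglongrightarrow> s" by simp
    show "eventually (\<lambda>n. s - t * (1/2) ^ n \<le> p n) sequentially"
    proof (intro always_eventually allI)
      fix n
      have "t * (1/2) ^ n = t / 2 ^ n" by (simp add: power_divide)
      then show "s - t * (1/2) ^ n \<le> p n" using p_s(2)[of n] by linarith
    qed
    show "eventually (\<lambda>n. p n \<le> s) sequentially"
      using p_s(1) by simp
  qed
  then have "(\<lambda>j. p (m + j)) \<longlonglongrightarrow> s"
    using LIMSEQ_ignore_initial_segment[of p s m] by (simp add: add.commute)
  moreover have "eventually (\<lambda>j. p (m + j) \<in> {0..t}) sequentially"
  proof (intro always_eventually allI)
    fix j
    show "p (m + j) \<in> {0..t}" using p0[of "m + j"] p_s(1)[of "m + j"] s by simp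
  qed
  ultimately have "(\<lambda>j. x (p (m + j))) \<longlonglongrightarrow> x s"
    using cont s s0 by (intro continuous_on_tendsto_compose[OF cont]) auto
  then have "(\<lambda>j. \<bar>x (p (m + j)) - x t\<bar>) \<longlonglongrightarrow> \<bar>x s - x t\<bar>"
    by (intro tendsto_intros)
  then have "\<bar>x s - x t\<bar> \<le> (t / 2 ^ m) powr \<alpha> * (1 / (1 - \<rho>))"
  proof (rule LIMSEQ_le_const2, intro exI allI impI)
    fix j
    show "\<bar>x (p (m + j)) - x t\<bar> \<le> (t / 2 ^ m) powr \<alpha> * (1 / (1 - \<rho>))"
      by (rule order_trans[OF partial], rule mult_left_mono[OF geo]) simp
  qed
  also have "\<dots> \<le> (2 * (t - s)) powr \<alpha> * (1 / (1 - \<rho>))"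
    using m(3) t \<rho> \<alpha> by (intro mult_right_mono powr_mono2) auto
  also have "\<dots> = (2 powr \<alpha> / (1 - \<rho>)) * (t - s) powr \<alpha>"
    by (simp only: powr_mult) (simp add: field_simps)
  finally show "\<bar>x s - x t\<bar> \<le> (2 powr \<alpha> / (1 - (1/2) powr \<alpha>)) * (t - s) powr \<alpha>"
    by (simp add: \<rho>_def)
qed

section \<open>Hoelder continuity of the process at a fixed time\<close>

context usual_filtered_prob_space
begin

text \<open>
  The threshold \<open>(t - s) powr (h / 4)\<close> is large compared with the standard deviation, which is at most
  of order \<open>(t - s) powr (h / 2)\<close>. The constant is \<open>2916 = 9 * 18 * 18\<close>, from the three equal parts of
  the threshold, the tail bound and the estimate of the kernel.
\<close>

lemma rfbm_increment_tail:
  assumes rf: "responsive_fbm M F T B H X"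
    and h: "0 < h" "h < 1" and H: "\<And>u y. u \<in> {0..T} \<Longrightarrow> h \<le> H u y \<and> H u y < 1"
    and st: "0 \<le> s" "s < t" "t \<le> T" and R: "1 \<le> R" "T \<le> R"
  shows "prob {\<omega>\<in>space M. \<bar>X t \<omega> - X s \<omega>\<bar> > (t - s) powr (h / 4)}
    \<le> 2 * exp (- (h ^ 3 / (2916 * R ^ 3) * (t - s) powr (- (h / 2))))"
proof -
  let ?d = "t - s"
  define v where "v = 18 * R ^ 3 / h ^ 3 * ?d powr h"
  have B: "brownian_motion M F T B"
    and ito: "has_ito_integral M F B u (\<lambda>r \<omega>. rfbm_kernel H u r (X r \<omega>)) (X u)" if "u \<in> {0..T}" for u
    using rf that unfolding responsive_fbm_def by auto
  have v: "v > 0" using R h st by (simp add: v_def)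
  have "prob {\<omega>\<in>space M. \<bar>X t \<omega> - X s \<omega>\<bar> > 3 * (?d powr (h / 4) / 3)}
      \<le> 2 * exp (- ((?d powr (h / 4) / 3)\<^sup>2 / (18 * v)))"
  proof (rule ito_difference_tail[OF _ st(1) less_imp_le[OF st(2)] st(3) ito ito _ _ v])
    show "brownian_motion M F T B" using B[of s] st by simp
    show "AE \<omega> in M. (\<integral>\<^sup>+u\<in>{0..t}. ennreal ((rfbm_kernel H t u (X u \<omega>)
        - indicator {0..s} u * rfbm_kernel H s u (X u \<omega>))\<^sup>2) \<partial>lborel) \<le> ennreal v"
      unfolding v_def using H h st R
      by (intro always_eventually allI rfbm_kernel_increment_L2) auto
  qed (use st in auto)
  moreover have "(?d powr (h / 4) / 3)\<^sup>2 / (18 * v) = h ^ 3 / (2916 * R ^ 3) * ?d powr (- (h / 2))"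
  proof -
    have 1: "(?d powr (h / 4))\<^sup>2 = ?d powr (h / 2)"
      by (simp add: power2_eq_square powr_add[symmetric])
    have 2: "?d powr (- (h / 2)) = ?d powr (h / 2) / ?d powr h"
      using st by (simp add: powr_diff[symmetric])
    show ?thesis
      unfolding v_def 2 power_divide 1 using R h st by (simp add: field_simps)
  qed
  ultimately show ?thesis by simp
qed

text \<open>
  Borel--Cantelli over the dyadic subdivisions of \<open>[0, t]\<close>: level \<open>n\<close> has $2^n$ increments, and each
  exceeds its threshold with a probability that decays faster than any power of $2^{-n}$.
\<close>

lemma rfbm_hoelder_at_left:
  assumes rf: "responsive_fbm M F T B H X" and lh: "lipschitz_hoelder_response T H"
    and t: "t \<in> {0<..T}"
  shows "\<exists>\<alpha>>0. AE \<omega> in M. \<exists>C. \<forall>\<^sub>F s in at_left t. \<bar>X s \<omega> - X t \<omega>\<bar> \<le> C * (t - s) powr \<alpha>"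
proof -
  obtain h hmax where h: "0 < h" "h \<le> hmax" "hmax < 1"
    and H: "\<And>u y. u \<in> {0..T} \<Longrightarrow> h \<le> H u y \<and> H u y \<le> hmax"
    using lh unfolding lipschitz_hoelder_response_def by blast
  define R where "R = max 1 T"
  define c where "c = h ^ 3 / (2916 * R ^ 3) * t powr (- (h / 2))"
  define q where "q = (2::real) powr (h / 2)"
  have R: "1 \<le> R" "T \<le> R" by (auto simp: R_def)
  have c: "c > 0" using h R t by (simp add: c_def)
  have q: "q > 1" using h by (simp add: q_def)
  define E where "E n i = {\<omega>\<in>space M. \<bar>X (t * real (Suc i) / 2 ^ n) \<omega> - X (t * real i / 2 ^ n) \<omega>\<bar> > (t / 2 ^ n) powr (h / 4)}" for n i
  define A where "A n = (\<Union>i<(2::nat) ^ n. E n i)" for n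
  have grid: "0 \<le> t * real i / 2 ^ n" "t * real i / 2 ^ n < t * real (Suc i) / 2 ^ n"
    "t * real (Suc i) / 2 ^ n \<le> T" "t * real (Suc i) / 2 ^ n - t * real i / 2 ^ n = t / 2 ^ n"
    if "i < 2 ^ n" for i n
  proof -
    show "0 \<le> t * real i / 2 ^ n" "t * real i / 2 ^ n < t * real (Suc i) / 2 ^ n"
      using t by (auto simp: field_simps)
    have "Suc i \<le> 2 ^ n" using that by simp
    then have "real (Suc i) \<le> 2 ^ n" by (metis of_nat_le_iff of_nat_numeral of_nat_power)
    then have "t * real (Suc i) \<le> t * 2 ^ n" using t by (intro mult_left_mono) auto
    then have "t * real (Suc i) / 2 ^ n \<le> t" by (simp add: field_simps)
    then show "t * real (Suc i) / 2 ^ n \<le> T" using t by auto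
    show "t * real (Suc i) / 2 ^ n - t * real i / 2 ^ n = t / 2 ^ n" by (simp add: field_simps)
  qed
  have X: "X u \<in> borel_measurable M" if "u \<in> {0..T}" for u
    using rf that unfolding responsive_fbm_def has_ito_integral_def by blast
  have Xg [measurable]: "X (t * real i / 2 ^ n) \<in> borel_measurable M"
    "X (t * real (Suc i) / 2 ^ n) \<in> borel_measurable M" if "i < 2 ^ n" for i n
    using grid[OF that] by (auto intro!: X simp del: of_nat_Suc)
  have Em: "E n i \<in> events" if "i < 2 ^ n" for n i
    using Xg[OF that] unfolding E_def by measurable
  have Am: "A n \<in> events" for n
    unfolding A_def using Em by (intro sets.finite_UN) auto
  have scale: "(t / 2 ^ n) powr (- (h / 2)) = t powr (- (h / 2)) * q ^ n" for n
  proof -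
    have "(2 ^ n) powr (- (h / 2)) = inverse (q ^ n)"
      by (simp add: q_def powr_minus powr_powr powr_realpow[symmetric] mult.commute)
    moreover have "(t / 2 ^ n) powr (- (h / 2)) = t powr (- (h / 2)) / (2 ^ n) powr (- (h / 2))"
      by (rule powr_divide)
    ultimately show ?thesis by (simp only: divide_inverse inverse_inverse_eq)
  qed
  have tail: "prob (E n i) \<le> 2 * exp (- (c * q ^ n))" if "i < 2 ^ n" for n i
  proof -
    have H': "h \<le> H u y \<and> H u y < 1" if "u \<in> {0..T}" for u y
      using H[OF that, of y] h by auto
    have "h < 1" using h by simp
    have "prob (E n i) \<le> 2 * exp (- (h ^ 3 / (2916 * R ^ 3) * (t / 2 ^ n) powr (- (h / 2))))"
      using rfbm_increment_tail[OF rf h(1) \<open>h < 1\<close> H' grid(1-3)[OF that] R]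
      unfolding E_def grid(4)[OF that] by (simp only:)
    also have "h ^ 3 / (2916 * R ^ 3) * (t / 2 ^ n) powr (- (h / 2)) = c * q ^ n"
      by (simp only: scale c_def mult.assoc)
    finally show ?thesis .
  qed
  have A_le: "prob (A n) \<le> 2 * (2 ^ n * exp (- (c * q ^ n)))" for n
  proof -
    have "prob (A n) \<le> (\<Sum>i<2 ^ n. prob (E n i))"
      unfolding A_def using Em by (intro finite_measure_subadditive_finite) auto
    also have "\<dots> \<le> (\<Sum>i<(2::nat) ^ n. 2 * exp (- (c * q ^ n)))"
      using tail by (intro sum_mono) auto
    finally show ?thesis by simp
  qed
  have "summable (\<lambda>n. prob (A n))"
  proof (rule summable_comparison_test')
    show "summable (\<lambda>n. 2 * (2 ^ n * exp (- (c * q ^ n))))"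
      by (intro summable_mult summable_doubling_times_stretched_exponential c q)
    show "norm (prob (A n)) \<le> 2 * (2 ^ n * exp (- (c * q ^ n)))" if "0 \<le> n" for n
      using A_le[of n] by simp
  qed
  then have "AE \<omega> in M. eventually (\<lambda>n. \<omega> \<in> space M - A n) sequentially"
    using Am by (intro borel_cantelli_AE1) (auto simp: emeasure_eq_measure)
  moreover have "AE \<omega> in M. continuous_on {0..T} (\<lambda>u. X u \<omega>)"
    using rf unfolding responsive_fbm_def by blast
  ultimately have "AE \<omega> in M. \<exists>C. \<forall>\<^sub>F s in at_left t. \<bar>X s \<omega> - X t \<omega>\<bar> \<le> C * (t - s) powr (h / 4)"
  proof eventually_elim
    case (elim \<omega>)
    then obtain n0 where n0: "\<And>n. n \<ge> n0 \<Longrightarrow> \<omega> \<in> space M - A n"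
      unfolding eventually_sequentially by blast
    have "\<exists>C. \<forall>s. t - t / 2 ^ n0 \<le> s \<longrightarrow> s < t \<longrightarrow> \<bar>X s \<omega> - X t \<omega>\<bar> \<le> C * (t - s) powr (h / 4)"
    proof (rule hoelder_at_right_endpoint)
      show "continuous_on {0..t} (\<lambda>u. X u \<omega>)"
        using elim(2) by (rule continuous_on_subset) (use t in auto)
      show "\<bar>X (t * real (Suc i) / 2 ^ n) \<omega> - X (t * real i / 2 ^ n) \<omega>\<bar> \<le> (t / 2 ^ n) powr (h / 4)"
        if "n \<ge> n0" "i < 2 ^ n" for n i
        using n0[OF that(1)] that(2) unfolding A_def E_def by (auto simp: not_less simp del: of_nat_Suc)
    qed (use t h in auto)
    then obtain C where C: "\<And>s. t - t / 2 ^ n0 \<le> s \<Longrightarrow> s < t \<Longrightarrow> \<bar>X s \<omega> - X t \<omega>\<bar> \<le> C * (t - s) powr (h / 4)"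
      by blast
    have "t - t / 2 ^ n0 < t" using t by simp
    then have "\<forall>\<^sub>F s in at_left t. \<bar>X s \<omega> - X t \<omega>\<bar> \<le> C * (t - s) powr (h / 4)"
      using C unfolding eventually_at_left[OF \<open>t - t / 2 ^ n0 < t\<close>] by (intro exI[of _ "t - t / 2 ^ n0"]) auto
    then show ?case ..
  qed
  then show ?thesis using h by (intro exI[of _ "h / 4"]) auto
qed

end

section \<open>Attention weights along a single path\<close>

lemma not_AE_avoids_interval:
  fixes a b :: real
  assumes "a < b" "AE s in lborel. \<not> (a < s \<and> s < b)"
  shows False
proof -
  have "AE s in lborel. s \<notin> {a<..<b}" using assms(2) by simp
  then have "{a<..<b} \<in> null_sets lborel"
    by (subst AE_iff_null_sets) auto
  then show False using assms(1) by (simp add: null_sets_def)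
qed

lemma continuous_on_Icc_fun_upd:
  fixes f :: "real \<Rightarrow> real"
  assumes ab: "a < b" and cont: "continuous_on {a..<b} f" and lim: "(f \<longlongrightarrow> l) (at_left b)"
  shows "continuous_on {a..b} (f(b := l))"
  unfolding continuous_on_def
proof
  fix s assume s: "s \<in> {a..b}"
  show "(f(b := l) \<longlongrightarrow> (f(b := l)) s) (at s within {a..b})"
  proof (cases "s = b")
    case True
    have "(f(b := l) \<longlongrightarrow> l) (at_left b)"
      using lim by (rule Lim_transform_eventually) (auto simp: eventually_at_filter)
    then show ?thesis using True ab by (simp add: at_within_Icc_at_left)
  next
    case False
    then have sb: "s < b" "s \<in> {a..<b}" using s by auto
    have "at s within {a..b} = at s within {a..<b}"
      by (rule at_within_nhd[of _ "{..<b}"]) (use sb in auto)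
    moreover have "(f \<longlongrightarrow> f s) (at s within {a..<b})"
      using cont sb unfolding continuous_on_def by blast
    then have "(f(b := l) \<longlongrightarrow> f s) (at s within {a..<b})"
      by (rule Lim_transform_eventually) (auto simp: eventually_at_filter)
    ultimately show ?thesis using False by simp
  qed
qed

lemma response_along_path_continuous:
  assumes lh: "lipschitz_hoelder_response T H" and x: "continuous_on {0..T} x"
  shows "continuous_on {0..T} (\<lambda>s. H s (x s))"
  unfolding continuous_on_def
proof
  fix r assume r: "r \<in> {0..T}"
  obtain L C \<gamma> where \<gamma>: "\<gamma> > 0"
    and L: "\<And>s y z. s \<in> {0..T} \<Longrightarrow> \<bar>H s y - H s z\<bar> \<le> L * \<bar>y - z\<bar>"
    and C: "\<And>s u y. s \<in> {0..T} \<Longrightarrow> u \<in> {0..T} \<Longrightarrow> \<bar>H s y - H u y\<bar> \<le> C * \<bar>s - u\<bar> powr \<gamma>"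
    using lh unfolding lipschitz_hoelder_response_def by metis
  let ?g = "\<lambda>s. L * \<bar>x s - x r\<bar> + C * \<bar>s - r\<bar> powr \<gamma>"
  have xr: "(x \<longlongrightarrow> x r) (at r within {0..T})" using x r unfolding continuous_on_def by blast
  have "((\<lambda>s. \<bar>s - r\<bar> powr \<gamma>) \<longlongrightarrow> 0) (at r within {0..T})"
  proof (rule tendsto_zero_powrI)
    have "((\<lambda>s. \<bar>s - r\<bar>) \<longlongrightarrow> \<bar>r - r\<bar>) (at r within {0..T})" by (intro tendsto_intros)
    then show "((\<lambda>s. \<bar>s - r\<bar>) \<longlongrightarrow> 0) (at r within {0..T})" by simp
  qed (use \<gamma> in auto)
  then have "(?g \<longlongrightarrow> L * \<bar>x r - x r\<bar> + C * 0) (at r within {0..T})"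
    by (intro tendsto_intros xr)
  then have "(?g \<longlongrightarrow> 0) (at r within {0..T})" by simp
  moreover have "eventually (\<lambda>s. norm (H s (x s) - H r (x r)) \<le> ?g s) (at r within {0..T})"
    unfolding eventually_at_filter
  proof (intro always_eventually allI impI)
    fix s assume "s \<in> {0..T}"
    then have "\<bar>H s (x s) - H s (x r)\<bar> \<le> L * \<bar>x s - x r\<bar>" "\<bar>H s (x r) - H r (x r)\<bar> \<le> C * \<bar>s - r\<bar> powr \<gamma>"
      using L C r by auto
    then show "norm (H s (x s) - H r (x r)) \<le> ?g s" by simp
  qed
  ultimately have "((\<lambda>s. H s (x s) - H r (x r)) \<longlongrightarrow> 0) (at r within {0..T})"
    by (rule Lim_null_comparison[rotated])
  then show "((\<lambda>s. H s (x s)) \<longlongrightarrow> H r (x r)) (at r within {0..T})"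
    by (simp add: LIM_zero_iff)
qed

text \<open>
  The deterministic setting for one path: besides continuity it records a Hoelder modulus at \<open>t\<close>
  from the left, which almost every path of the process has.
\<close>

locale hoelder_path =
  fixes T :: real and H :: "real \<Rightarrow> real \<Rightarrow> real" and x :: "real \<Rightarrow> real" and t \<alpha> C :: real
  assumes response: "lipschitz_hoelder_response T H"
    and continuous: "continuous_on {0..T} x"
    and t: "0 < t" "t \<le> T"
    and \<alpha>: "\<alpha> > 0"
    and hoelder: "\<forall>\<^sub>F s in at_left t. \<bar>x s - x t\<bar> \<le> C * (t - s) powr \<alpha>"
begin

abbreviation e where "e s \<equiv> H s (x s)"
abbreviation K where "K s \<equiv> rfbm_kernel H t s (x s)"
abbreviation D where "D \<equiv> attention_normalizer H t x"
abbreviation \<rho> where "\<rho> \<equiv> attention_weight H t x"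

lemma e_bounds: "\<exists>h hmax. 0 < h \<and> hmax < 1 \<and> (\<forall>s\<in>{0..T}. h \<le> e s \<and> e s \<le> hmax)"
  using response unfolding lipschitz_hoelder_response_def by metis

lemma e_pos: "s \<in> {0..T} \<Longrightarrow> 0 < e s"
  using e_bounds by force

lemma e_continuous: "continuous_on {0..T} e"
  by (rule response_along_path_continuous[OF response continuous])

lemma eventually_left_t: "\<forall>\<^sub>F s in at_left t. s \<in> {0..<t}"
  using eventually_at_left_field[of "\<lambda>s. s \<in> {0..<t}" t] t by auto

lemma e_tendsto: "(e \<longlongrightarrow> e t) (at_left t)"
proof -
  have "continuous_on {0..t} e" using e_continuous by (rule continuous_on_subset) (use t in auto)
  then have "(e \<longlongrightarrow> e t) (at t within {0..t})" using t unfolding continuous_on_def by auto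
  then show ?thesis using t by (simp add: at_within_Icc_at_left)
qed

lemma kernel_pos: "s \<in> {0..<t} \<Longrightarrow> 0 < K s"
  using e_pos[of s] t by (simp add: rfbm_kernel_def)

lemma kernel_continuous: "continuous_on {0..<t} K"
  unfolding rfbm_kernel_def
  by (intro continuous_intros continuous_on_subset[OF e_continuous]) (use t in auto)

text \<open>
  Near \<open>t\<close> the kernel is dominated by a multiple of \<open>(t - s) powr (h - 1/2)\<close>, where \<open>h > 0\<close> is a lower
  bound of the response.
\<close>

lemma kernel_integrable: "set_integrable lborel {0..<t} K"
proof -
  obtain h hmax where h: "0 < h" "hmax < 1" and eh: "\<And>s. s \<in> {0..T} \<Longrightarrow> h \<le> e s \<and> e s \<le> hmax"
    using e_bounds by blast
  define R where "R = max 1 T"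
  have R: "1 \<le> R" "T \<le> R" by (auto simp: R_def)
  have bound: "K s \<le> 2 * (R * (t - s) powr (h - 1/2))" if s: "s \<in> {0..<t}" for s
  proof -
    have es: "h \<le> e s" "e s < 1" using eh[of s] s t h by auto
    have "(t - s) powr (e s - h) \<le> R powr (e s - h)"
      using s R t es by (intro powr_mono2) auto
    also have "\<dots> \<le> R powr 1" using R es h by (intro powr_mono) auto
    finally have 1: "(t - s) powr (e s - h) \<le> R" using R by simp
    have "(t - s) powr (e s - 1/2) = (t - s) powr (e s - h) * (t - s) powr (h - 1/2)"
      by (simp add: powr_add[symmetric])
    also have "\<dots> \<le> R * (t - s) powr (h - 1/2)" by (rule mult_right_mono[OF 1]) simp
    finally have 2: "(t - s) powr (e s - 1/2) \<le> R * (t - s) powr (h - 1/2)" .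
    have "sqrt (2 * e s) \<le> 2" using es by (intro real_le_lsqrt) auto
    with 2 show ?thesis unfolding rfbm_kernel_def using R by (intro mult_mono) auto
  qed
  have "(\<integral>\<^sup>+s. ennreal (norm (indicator {0..<t} s *\<^sub>R K s)) \<partial>lborel)
      \<le> (\<integral>\<^sup>+s. ennreal (2 * R) * (ennreal ((t - s) powr (h - 1/2)) * indicator {0..t} s) \<partial>lborel)"
  proof (rule nn_integral_mono)
    fix s
    show "ennreal (norm (indicator {0..<t} s *\<^sub>R K s)) \<le> ennreal (2 * R) * (ennreal ((t - s) powr (h - 1/2)) * indicator {0..t} s)"
    proof (cases "s \<in> {0..<t}")
      case True
      then have "ennreal (K s) \<le> ennreal (2 * R * (t - s) powr (h - 1/2))"
        using bound by (intro ennreal_leI) (simp add: mult.assoc)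
      then show ?thesis using True kernel_pos[OF True] R by (simp add: ennreal_mult abs_of_pos)
    next
      case False
      then show ?thesis by (simp add: indicator_def)
    qed
  qed
  also have "\<dots> = ennreal (2 * R) * ennreal (t powr (h + 1/2) / (h + 1/2))"
    using nn_integral_powr_to_endpoint[of "h - 1/2" 0 t] h t
    by (subst nn_integral_cmult) (auto simp: add.commute)
  also have "\<dots> < \<infinity>" by (simp add: ennreal_mult_less_top)
  finally show ?thesis
    unfolding set_integrable_def
    using borel_measurable_continuous_on_indicator[OF _ kernel_continuous]
    by (intro integrableI_bounded) (auto simp: scaleR_conv_of_real)
qed

lemma normalizer_pos: "0 < D"
proof -
  let ?f = "\<lambda>s. indicator {0..<t} s *\<^sub>R K s"
  have int: "integrable lborel ?f" using kernel_integrable unfolding set_integrable_def .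
  have nonneg: "AE s in lborel. 0 \<le> ?f s"
    using kernel_pos by (intro always_eventually) (auto simp: indicator_def intro: less_imp_le)
  have D: "D = (\<integral>s. ?f s \<partial>lborel)"
    by (simp add: attention_normalizer_def set_lebesgue_integral_def)
  have "D \<noteq> 0"
  proof
    assume "D = 0"
    then have "AE s in lborel. ?f s = 0"
      using integral_nonneg_eq_0_iff_AE[OF int nonneg] D by simp
    then have "AE s in lborel. \<not> (0 < s \<and> s < t)"
    proof eventually_elim
      case (elim s)
      then show ?case using kernel_pos[of s] by auto
    qed
    then show False using not_AE_avoids_interval t by blast
  qed
  moreover have "0 \<le> D" unfolding D by (rule integral_nonneg_AE[OF nonneg])
  ultimately show ?thesis by simp
qed

lemma weight_eq: "\<rho> s = K s / D"
  by (simp add: attention_weight_def)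

lemma weight_pos: "s \<in> {0..<t} \<Longrightarrow> 0 < \<rho> s"
  using kernel_pos normalizer_pos by (simp add: weight_eq)

lemma weight_integrable: "set_integrable lborel {0..<t} \<rho>"
  using kernel_integrable unfolding weight_eq[abs_def] by (rule set_integrable_divide)

lemma weight_integral: "(LBINT s:{0..<t}. \<rho> s) = 1"
proof -
  have "(LBINT s:{0..<t}. \<rho> s) = (LBINT s:{0..<t}. K s) / D"
    unfolding weight_eq by (rule set_integral_divide_zero)
  then show ?thesis using normalizer_pos by (simp add: attention_normalizer_def)
qed

lemma weight_continuous: "continuous_on {0..<t} \<rho>"
  unfolding weight_eq[abs_def] using normalizer_pos
  by (intro continuous_on_divide kernel_continuous continuous_on_const) auto

lemma kernel_exp_form: "\<forall>\<^sub>F s in at_left t. sqrt (2 * e s) * exp ((e s - 1/2) * ln (t - s)) = K s"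
  using eventually_left_t by eventually_elim (simp add: rfbm_kernel_def powr_def)

lemma ln_distance_at_bot: "filterlim (\<lambda>s. ln (t - s)) at_bot (at_left t)"
proof -
  have "filterlim (\<lambda>s. t - s) (at_right 0) (at_left t)"
    by real_asymp
  then show ?thesis by (rule filterlim_compose[OF ln_at_0])
qed

lemma sqrt_tendsto: "((\<lambda>s. sqrt (2 * e s)) \<longlongrightarrow> sqrt (2 * e t)) (at_left t)"
  by (intro tendsto_intros e_tendsto)

lemma sqrt_pos: "0 < sqrt (2 * e t)"
  using e_pos[of t] t by simp

lemma kernel_tendsto_above:
  assumes "e t > 1/2"
  shows "(K \<longlongrightarrow> 0) (at_left t)"
proof -
  have "((\<lambda>s. e s - 1/2) \<longlongrightarrow> e t - 1/2) (at_left t)" by (intro tendsto_intros e_tendsto)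
  then have "filterlim (\<lambda>s. (e s - 1/2) * ln (t - s)) at_bot (at_left t)"
    using assms by (intro filterlim_tendsto_pos_mult_at_bot[OF _ _ ln_distance_at_bot]) auto
  then have "((\<lambda>s. exp ((e s - 1/2) * ln (t - s))) \<longlongrightarrow> 0) (at_left t)"
    by (rule filterlim_compose[OF exp_at_bot])
  from tendsto_mult[OF sqrt_tendsto this] show ?thesis
    by (intro Lim_transform_eventually[OF _ kernel_exp_form]) simp
qed

lemma kernel_tendsto_below:
  assumes "e t < 1/2"
  shows "filterlim K at_top (at_left t)"
proof -
  have "((\<lambda>s. - (e s - 1/2)) \<longlongrightarrow> - (e t - 1/2)) (at_left t)" by (intro tendsto_intros e_tendsto)
  moreover have "filterlim (\<lambda>s. - ln (t - s)) at_top (at_left t)"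
    using ln_distance_at_bot by (simp add: filterlim_uminus_at_top)
  ultimately have "filterlim (\<lambda>s. - (e s - 1/2) * - ln (t - s)) at_top (at_left t)"
    using assms by (intro filterlim_tendsto_pos_mult_at_top) auto
  then have "filterlim (\<lambda>s. (e s - 1/2) * ln (t - s)) at_top (at_left t)"
    by (simp only: minus_mult_minus)
  then have "filterlim (\<lambda>s. exp ((e s - 1/2) * ln (t - s))) at_top (at_left t)"
    by (rule filterlim_compose[OF exp_at_top])
  from filterlim_tendsto_pos_mult_at_top[OF sqrt_tendsto sqrt_pos this] show ?thesis
    by (rule filterlim_mono_eventually[OF _ order_refl order_refl kernel_exp_form])
qed

text \<open>
  This is where the modulus of continuity of the path at \<open>t\<close> is used: continuity alone gives no rate
  that beats the logarithm.
\<close>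

lemma response_log_tendsto: "((\<lambda>s. (e s - e t) * ln (t - s)) \<longlongrightarrow> 0) (at_left t)"
proof -
  obtain L C' \<gamma> where L0: "L > 0" and \<gamma>: "\<gamma> > 0"
    and L: "\<And>s y z. s \<in> {0..T} \<Longrightarrow> \<bar>H s y - H s z\<bar> \<le> L * \<bar>y - z\<bar>"
    and C': "\<And>s u y. s \<in> {0..T} \<Longrightarrow> u \<in> {0..T} \<Longrightarrow> \<bar>H s y - H u y\<bar> \<le> C' * \<bar>s - u\<bar> powr \<gamma>"
    using response unfolding lipschitz_hoelder_response_def by metis
  let ?g = "\<lambda>s. (L * (C * (t - s) powr \<alpha>) + C' * (t - s) powr \<gamma>) * \<bar>ln (t - s)\<bar>"
  have pl: "((\<lambda>s. (t - s) powr b * \<bar>ln (t - s)\<bar>) \<longlongrightarrow> 0) (at_left t)" if "b > 0" for b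
    using that by real_asymp
  have "((\<lambda>s. L * C * ((t - s) powr \<alpha> * \<bar>ln (t - s)\<bar>) + C' * ((t - s) powr \<gamma> * \<bar>ln (t - s)\<bar>)) \<longlongrightarrow> L * C * 0 + C' * 0) (at_left t)"
    by (intro tendsto_add tendsto_mult tendsto_const pl \<alpha> \<gamma>)
  then have "(?g \<longlongrightarrow> 0) (at_left t)" by (simp add: algebra_simps)
  moreover have "\<forall>\<^sub>F s in at_left t. norm ((e s - e t) * ln (t - s)) \<le> ?g s"
    using hoelder eventually_left_t
  proof eventually_elim
    case (elim s)
    have s: "s \<in> {0..T}" "t \<in> {0..T}" "\<bar>s - t\<bar> = t - s" using elim(2) t by auto
    have "\<bar>e s - H s (x t)\<bar> \<le> L * \<bar>x s - x t\<bar>" by (rule L[OF s(1)])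
    also have "\<dots> \<le> L * (C * (t - s) powr \<alpha>)" using elim(1) L0 by (intro mult_left_mono) auto
    finally have "\<bar>e s - H s (x t)\<bar> \<le> L * (C * (t - s) powr \<alpha>)" .
    moreover have "\<bar>H s (x t) - e t\<bar> \<le> C' * (t - s) powr \<gamma>"
      using C'[OF s(1,2)] s(3) by metis
    ultimately have "\<bar>e s - e t\<bar> \<le> L * (C * (t - s) powr \<alpha>) + C' * (t - s) powr \<gamma>" by linarith
    then show ?case by (simp only: real_norm_def abs_mult) (rule mult_right_mono, auto)
  qed
  ultimately show ?thesis by (rule Lim_null_comparison[rotated])
qed

lemma kernel_tendsto_critical:
  assumes "e t = 1/2"
  shows "(K \<longlongrightarrow> sqrt (2 * e t)) (at_left t)"
proof -
  have "((\<lambda>s. exp ((e s - 1/2) * ln (t - s))) \<longlongrightarrow> exp 0) (at_left t)"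
    using response_log_tendsto assms by (intro tendsto_exp) simp
  from tendsto_mult[OF sqrt_tendsto this] show ?thesis
    by (intro Lim_transform_eventually[OF _ kernel_exp_form]) simp
qed

lemma not_in_Linfty_if_at_top:
  assumes "filterlim f at_top (at_left t)"
  shows "\<not> in_Linfty_on {0..<t} f"
proof
  assume "in_Linfty_on {0..<t} f"
  then obtain c where c: "AE s in lborel. s \<in> {0..<t} \<longrightarrow> \<bar>f s\<bar> \<le> c"
    unfolding in_Linfty_on_def by blast
  have "\<forall>\<^sub>F s in at_left t. c < f s" using assms by (simp add: filterlim_at_top_dense)
  then obtain b where b: "b < t" "\<And>s. b < s \<Longrightarrow> s < t \<Longrightarrow> c < f s"
    unfolding eventually_at_left_field by blast
  have "AE s in lborel. \<not> (max b 0 < s \<and> s < t)"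
    using c by eventually_elim (use b(2) in force)
  then show False using not_AE_avoids_interval[of "max b 0" t] b(1) t by simp
qed

lemma weight_tendsto_above: "e t > 1/2 \<Longrightarrow> (\<rho> \<longlongrightarrow> 0) (at_left t)"
  using tendsto_divide[OF kernel_tendsto_above tendsto_const[of D]] normalizer_pos
  by (simp add: weight_eq[abs_def])

lemma weight_tendsto_critical: "e t = 1/2 \<Longrightarrow> (\<rho> \<longlongrightarrow> sqrt (2 * e t) / D) (at_left t)"
  unfolding weight_eq[abs_def] using normalizer_pos
  by (intro tendsto_divide kernel_tendsto_critical tendsto_const) auto

lemma weight_tendsto_below: "e t < 1/2 \<Longrightarrow> filterlim \<rho> at_top (at_left t)"
  using filterlim_tendsto_pos_mult_at_top[OF tendsto_const[of "1 / D"] _ kernel_tendsto_below] normalizer_pos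
  by (simp add: weight_eq[abs_def])

lemma weight_limit_exists: "\<exists>l::ereal. 0 \<le> l \<and> ((\<lambda>s. ereal (\<rho> s)) \<longlongrightarrow> l) (at_left t)"
proof -
  consider "e t > 1/2" | "e t = 1/2" | "e t < 1/2" by linarith
  then show ?thesis
  proof cases
    case 1
    then have "((\<lambda>s. ereal (\<rho> s)) \<longlongrightarrow> ereal 0) (at_left t)"
      by (intro tendsto_ereal weight_tendsto_above)
    then show ?thesis by (intro exI[of _ "ereal 0"]) auto
  next
    case 2
    then have "((\<lambda>s. ereal (\<rho> s)) \<longlongrightarrow> ereal (sqrt (2 * e t) / D)) (at_left t)"
      by (intro tendsto_ereal weight_tendsto_critical)
    moreover have "0 \<le> ereal (sqrt (2 * e t) / D)"
      using sqrt_pos normalizer_pos by simp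
    ultimately show ?thesis by blast
  next
    case 3
    then have "((\<lambda>s. ereal (\<rho> s)) \<longlongrightarrow> \<infinity>) (at_left t)"
      by (simp add: tendsto_PInfty_eq_at_top weight_tendsto_below)
    then show ?thesis by (intro exI[of _ "\<infinity>"]) auto
  qed
qed

end

section \<open>Almost sure behaviour of the attention weights\<close>

theorem theorem6p3:
  fixes M :: "'a measure" and F :: "real \<Rightarrow> 'a measure" and T :: real
    and B X :: "real \<Rightarrow> 'a \<Rightarrow> real" and H :: "real \<Rightarrow> real \<Rightarrow> real"
  assumes "T > 0"
    and "lipschitz_hoelder_response T H"
    and "responsive_fbm M F T B H X"
  shows "\<forall>t\<in>{0<..T}. \<exists>N\<in>null_sets M. \<forall>\<omega>\<in>space M - N.
    (let x = (\<lambda>u. X u \<omega>); \<rho> = attention_weight H t x; D = attention_normalizer H t x;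
         h = H t (X t \<omega>)
     in
       (\<forall>s\<in>{0..<t}. \<rho> s > 0) \<and>
       (\<exists>l::ereal. 0 \<le> l \<and> ((\<lambda>s. ereal (\<rho> s)) \<longlongrightarrow> l) (at_left t)) \<and>
       set_integrable lborel {0..<t} \<rho> \<and> (LBINT s:{0..<t}. \<rho> s) = 1 \<and>
       continuous_on {0..<t} \<rho> \<and>
       (h > 1/2 \<longrightarrow>
          (\<rho> \<longlongrightarrow> 0) (at_left t) \<and> continuous_on {0..t} (\<rho>(t := 0))) \<and>
       (h = 1/2 \<longrightarrow>
          (\<rho> \<longlongrightarrow> sqrt (2 * h) / D) (at_left t) \<and> 0 < sqrt (2 * h) / D \<and>
          continuous_on {0..t} (\<rho>(t := sqrt (2 * h) / D))) \<and>
       (h < 1/2 \<longrightarrow>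
          filterlim \<rho> at_top (at_left t) \<and>
          set_integrable lborel {0..<t} \<rho> \<and> \<not> in_Linfty_on {0..<t} \<rho>))"
proof
  let "\<forall>t\<in>_. \<exists>N\<in>_. \<forall>\<omega>\<in>_. ?claim t \<omega>" = ?thesis
  fix t assume t: "t \<in> {0<..T}"
  interpret usual_filtered_prob_space M F T
    using assms(3) unfolding responsive_fbm_def by blast
  obtain \<alpha> where \<alpha>: "\<alpha> > 0"
    and hoelder: "AE \<omega> in M. \<exists>C. \<forall>\<^sub>F s in at_left t. \<bar>X s \<omega> - X t \<omega>\<bar> \<le> C * (t - s) powr \<alpha>"
    using rfbm_hoelder_at_left[OF assms(3,2) t] by blast
  have "AE \<omega> in M. continuous_on {0..T} (\<lambda>u. X u \<omega>)"
    using assms(3) unfolding responsive_fbm_def by blast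
  with hoelder have "AE \<omega> in M. continuous_on {0..T} (\<lambda>u. X u \<omega>) \<and>
      (\<exists>C. \<forall>\<^sub>F s in at_left t. \<bar>X s \<omega> - X t \<omega>\<bar> \<le> C * (t - s) powr \<alpha>)"
    by eventually_elim blast
  then obtain N where N: "N \<in> null_sets M"
    and regular: "\<And>\<omega>. \<omega> \<in> space M - N \<Longrightarrow> continuous_on {0..T} (\<lambda>u. X u \<omega>) \<and>
      (\<exists>C. \<forall>\<^sub>F s in at_left t. \<bar>X s \<omega> - X t \<omega>\<bar> \<le> C * (t - s) powr \<alpha>)"
    by (rule AE_E3) blast
  show "\<exists>N\<in>null_sets M. \<forall>\<omega>\<in>space M - N. ?claim t \<omega>"
  proof (rule bexI[OF _ N], rule ballI)
    fix \<omega> assume "\<omega> \<in> space M - N"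
    from regular[OF this] obtain C where
      "continuous_on {0..T} (\<lambda>u. X u \<omega>)"
      "\<forall>\<^sub>F s in at_left t. \<bar>X s \<omega> - X t \<omega>\<bar> \<le> C * (t - s) powr \<alpha>"
      by blast
    then interpret path: hoelder_path T H "\<lambda>u. X u \<omega>" t \<alpha> C
      using t \<alpha> assms(2) by unfold_locales auto
    note extend = continuous_on_Icc_fun_upd[OF path.t(1) path.weight_continuous]
    have critical_pos: "0 < sqrt (2 * path.e t) / path.D"
      using path.sqrt_pos path.normalizer_pos by (rule divide_pos_pos)
    show "?claim t \<omega>"
      unfolding Let_def
      by (intro conjI impI ballI path.weight_pos path.weight_limit_exists path.weight_integrable
          path.weight_integral path.weight_continuous extend path.weight_tendsto_above
          path.weight_tendsto_critical path.weight_tendsto_below path.not_in_Linfty_if_at_top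
          critical_pos; assumption)
  qed
qed

end
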